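(* Let $d\in\mathbb{N}$. For any probability distribution $Q$ on $\mathbb{R}^d$, the value of $L(Q)$ is real if and only if $$\int \|x\|\,Q(dx)<\infty\quad\text{and}\quad \operatorname{interior}(\operatorname{csupp}(Q))\neq\varnothing .$$ In that case, there exists a unique function $$\psi=\psi(\cdot\,|\,Q)\in\operatorname*{arg\,max}_{\phi\in\Phi}L(\phi,Q).$$ This function $\psi$ satisfies $\int e^{\psi(x)}\,dx=1$ and $$\operatorname{interior}(\operatorname{csupp}(Q))\subseteq \operatorname{dom}(\psi):=\{x\in\mathbb{R}^d:\psi(x)>-\infty\}\subseteq\operatorname{csupp}(Q).$$
   Context: $\Phi=\Phi(d)$ is the family of concave functions $\phi:\mathbb{R}^d\to[-\infty,\infty)$ which are upper semicontinuous and coercive, where coercive means $\phi(x)\to-\infty$ as $\|x\|\to\infty$. (Such $\phi$ are bounded above and $\int e^{\phi(x)}\,dx<\infty$, with $e^{-\infty}=0$.) For a probability distribution $Q$ on $\mathbb{R}^d$ and $\phi\in\Phi$, $$L(\phi,Q):=\int\phi\,dQ-\int e^{\phi(x)}\,dx+1\in[-\infty,\infty),\qquad L(Q):=\sup_{\phi\in\Phi}L(\phi,Q)\in[-\infty,\infty].$$ The convex support of $Q$ is $\operatorname{csupp}(Q):=\bigcap\{C: C\subseteq\mathbb{R}^d\text{ closed and convex},\ Q(C)=1\}$. *)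

theory Defs
  imports "HOL-Probability.Probability"
begin

text \<open>
  Functions with values in \<open>[-\<infinity>, \<infinity>)\<close> are represented as \<open>ereal\<close>-valued functions that never
  take the value \<open>\<infinity>\<close>. The library's \<open>concave_on\<close> only covers real-valued functions.
  The right-hand side below is never \<open>\<infinity> - \<infinity>\<close> when \<open>f < \<infinity>\<close>.
\<close>

definition concave_ereal :: "('a::real_vector \<Rightarrow> ereal) \<Rightarrow> bool" where
  "concave_ereal f \<longleftrightarrow>
     (\<forall>x y. \<forall>t::real. 0 < t \<and> t < 1 \<longrightarrow>
        ereal (1 - t) * f x + ereal t * f y \<le> f ((1 - t) *\<^sub>R x + t *\<^sub>R y))"

definition upper_semicont :: "('a::topological_space \<Rightarrow> ereal) \<Rightarrow> bool" where
  "upper_semicont f \<longleftrightarrow> (\<forall>x. Limsup (at x) f \<le> f x)"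

definition coercive :: "('a::real_normed_vector \<Rightarrow> ereal) \<Rightarrow> bool" where
  "coercive f \<longleftrightarrow> (f \<longlongrightarrow> - \<infinity>) at_infinity"

definition Phi :: "('a::euclidean_space \<Rightarrow> ereal) set" where
  "Phi = {f. (\<forall>x. f x \<noteq> \<infinity>) \<and> concave_ereal f \<and> upper_semicont f \<and> coercive f}"

definition exp_ereal :: "ereal \<Rightarrow> ennreal" where
  "exp_ereal x = (case x of ereal r \<Rightarrow> ennreal (exp r) | PInfty \<Rightarrow> \<infinity> | MInfty \<Rightarrow> 0)"

text \<open>
  The extended integral: integral of the positive part minus integral of the negative part
  (\<open>e2ennreal\<close> maps negative arguments to \<open>0\<close>). It is meaningful only if one of the two is finite;
  for \<open>f \<in> Phi\<close> and a probability measure the first one is, since \<open>f\<close> is bounded above.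
\<close>

definition ext_integral :: "'a measure \<Rightarrow> ('a \<Rightarrow> ereal) \<Rightarrow> ereal" where
  "ext_integral M f =
     enn2ereal (\<integral>\<^sup>+x. e2ennreal (f x) \<partial>M) - enn2ereal (\<integral>\<^sup>+x. e2ennreal (- f x) \<partial>M)"

definition L_fun :: "('a::euclidean_space \<Rightarrow> ereal) \<Rightarrow> 'a measure \<Rightarrow> ereal" where
  "L_fun f Q = ext_integral Q f - enn2ereal (\<integral>\<^sup>+x. exp_ereal (f x) \<partial>lborel) + 1"

definition L_sup :: "'a::euclidean_space measure \<Rightarrow> ereal" where
  "L_sup Q = (SUP f\<in>Phi. L_fun f Q)"

definition csupp :: "'a::euclidean_space measure \<Rightarrow> 'a set" where
  "csupp Q = \<Inter>{C. closed C \<and> convex C \<and> emeasure Q C = 1}"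

definition eff_dom :: "('a \<Rightarrow> ereal) \<Rightarrow> 'a set" where
  "eff_dom f = {x. f x > - \<infinity>}"

end

theory Submission
  imports Defs "HOL-Real_Asymp.Real_Asymp"
begin

text \<open>
  Bound a function \<open>f \<in> Phi\<close> by a real \<open>M \<ge> 0\<close>. Then
  \<open>L_fun f Q = M + 1 - cost M f\<close>, where \<open>cost M f\<close> is the sum of the integrals of the nonnegative
  functions \<open>M - f\<close> (with respect to \<open>Q\<close>) and \<open>exp f\<close> (with respect to Lebesgue measure).
  Maximizing \<open>L_fun\<close> thus means minimizing a sum of two nonnegative integrals, for which Fatou's lemma
  is available. Membership in \<open>Phi\<close> is expressed through the hypograph: it is closed and convex,
  and the superlevel sets are bounded.

  \<^bold>\<open>When the supremum is real.\<close> Every \<open>f \<in> Phi\<close> is at most \<open>a - b * norm x\<close> with \<open>b > 0\<close>, so an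
  infinite first moment forces \<open>L_fun f Q = -\<infinity>\<close>. If the convex support has empty interior, it
  lies in a hyperplane, on which \<open>n - norm x\<close> costs nothing in the Lebesgue integral, and
  \<open>n \<rightarrow> \<infinity>\<close> gives the value \<open>\<infinity>\<close>. Conversely, let \<open>z\<close> be interior to the convex support. There are
  \<open>r, \<delta> > 0\<close> such that each closed convex set of probability more than \<open>1 - \<delta>\<close> contains
  \<open>cball z r\<close> (\<open>convex_contains_ball_of_large_prob\<close>). For a superlevel set of \<open>f\<close> this leaves two
  cases: either \<open>f\<close> is very small with probability at least \<open>\<delta>\<close>, or it is bounded below on a ball,
  and then concavity turns a high peak of \<open>f\<close> into a large integral of \<open>exp f\<close>. Hence all
  functions with \<open>L_fun f Q \<ge> - C\<close> have a common upper bound, and a common lower bound near \<open>z\<close>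
  (\<open>Phi_uniform_bounds\<close>).

  \<^bold>\<open>Uniqueness and existence.\<close> The linear part of the cost is affine along midpoints, and the
  exponential part obeys a parallelogram identity, so that
  \<open>cost f + cost g = 2 * cost ((f + g) / 2) + \<integral> (exp (f/2) - exp (g/2))\<^sup>2\<close> (\<open>cost_midpoint\<close>). Two near-maximizers
  are therefore close in the sense that the functions \<open>exp (f/2)\<close> are close in the L2 norm. For two
  maximizers this gives equality almost everywhere, hence everywhere by concavity and semicontinuity.
  For a maximizing sequence that approaches the supremum fast enough it gives convergence almost
  everywhere, without passing to subsequences. The upper semicontinuous hull \<open>\<psi>\<close> of the
  pointwise lower limit is concave. It agrees with the lower limit almost everywhere, because
  the frontier of a convex set is a null set, and it dominates the upper limit everywhere, because
  the sequence is bounded below on a ball. Fatou's lemma, applied to both integrals, shows that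
  \<open>\<psi>\<close> is a maximizer; it is coercive because \<open>exp \<psi>\<close> is integrable.

  \<^bold>\<open>Properties of the maximizer.\<close> Adding a constant to \<open>\<psi>\<close> cannot improve the value, which
  forces \<open>exp \<psi>\<close> to have integral 1. Setting \<open>\<psi>\<close> to \<open>-\<infinity>\<close> off the convex support does not
  decrease the value either, so that by uniqueness \<open>\<psi>\<close> already is \<open>-\<infinity>\<close> there. The lower bounds near
  interior points show that the domain contains the interior of the convex support.
\<close>

section \<open>Hypographs and the class Phi\<close>

definition hypograph :: "('a \<Rightarrow> ereal) \<Rightarrow> ('a \<times> real) set" where
  "hypograph f = {p. ereal (snd p) \<le> f (fst p)}"

lemma mem_hypograph [simp]: "(x, a) \<in> hypograph f \<longleftrightarrow> ereal a \<le> f x"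
  by (simp add: hypograph_def)

lemma ereal_le_if_real_le:
  fixes u v :: ereal
  assumes "\<And>a. ereal a \<le> u \<Longrightarrow> ereal a \<le> v"
  shows "u \<le> v"
proof (rule ccontr)
  assume "\<not> u \<le> v"
  then obtain a where "v < ereal a" "ereal a < u"
    using ereal_dense2 by (meson not_le)
  with assms[of a] show False by (meson less_imp_le not_le)
qed

text \<open>
  If the concavity inequality involves the value \<open>-\<infinity>\<close> then its left-hand side is \<open>-\<infinity>\<close>; otherwise
  it only concerns the finite values, whose graph points lie in the hypograph.
\<close>

lemma concave_ereal_iff_convex_hypograph:
  fixes f :: "'a::real_vector \<Rightarrow> ereal"
  assumes fin: "\<And>x. f x \<noteq> \<infinity>"
  shows "concave_ereal f \<longleftrightarrow> convex (hypograph f)"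
proof
  assume c: "concave_ereal f"
  show "convex (hypograph f)"
    unfolding convex_alt
  proof (intro ballI allI impI)
    fix p q and t :: real
    assume p: "p \<in> hypograph f" and q: "q \<in> hypograph f" and t: "0 \<le> t \<and> t \<le> 1"
    obtain x a where px: "p = (x, a)" by force
    obtain y b where qy: "q = (y, b)" by force
    have xa: "ereal a \<le> f x" "ereal b \<le> f y" using p q px qy by auto
    show "(1 - t) *\<^sub>R p + t *\<^sub>R q \<in> hypograph f"
    proof (cases "t = 0 \<or> t = 1")
      case True
      then show ?thesis using p q by auto
    next
      case False
      then have t': "0 < t" "t < 1" using t by auto
      have "ereal ((1 - t) * a + t * b) = ereal (1 - t) * ereal a + ereal t * ereal b" by simp
      also have "\<dots> \<le> ereal (1 - t) * f x + ereal t * f y"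
        using xa t' by (intro add_mono ereal_mult_left_mono) auto
      also have "\<dots> \<le> f ((1 - t) *\<^sub>R x + t *\<^sub>R y)"
        using c t' unfolding concave_ereal_def by blast
      finally show ?thesis by (simp add: px qy)
    qed
  qed
next
  assume c: "convex (hypograph f)"
  show "concave_ereal f"
    unfolding concave_ereal_def
  proof (intro allI impI)
    fix x y and t :: real
    assume t: "0 < t \<and> t < 1"
    show "ereal (1 - t) * f x + ereal t * f y \<le> f ((1 - t) *\<^sub>R x + t *\<^sub>R y)"
    proof (cases "f x = -\<infinity> \<or> f y = -\<infinity>")
      case True
      then show ?thesis using t fin[of x] fin[of y]
        by (cases "f x"; cases "f y") auto
    next
      case False
      then obtain a b where ab: "f x = ereal a" "f y = ereal b"
        using fin by (metis ereal_cases uminus_ereal.simps(2))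
      then have "(x, a) \<in> hypograph f" "(y, b) \<in> hypograph f" by auto
      then have "(1 - t) *\<^sub>R (x, a) + t *\<^sub>R (y, b) \<in> hypograph f"
        using c t unfolding convex_alt by (meson less_imp_le)
      then show ?thesis by (simp add: ab)
    qed
  qed
qed

text \<open>
  The definition refers to the punctured filter \<open>at x\<close>. The value at \<open>x\<close> itself is below \<open>b\<close> by
  hypothesis, so whole neighbourhoods may be used instead.
\<close>

lemma upper_semicont_iff_eventually:
  fixes f :: "'a::topological_space \<Rightarrow> ereal"
  shows "upper_semicont f \<longleftrightarrow> (\<forall>x b. f x < ereal b \<longrightarrow> (\<forall>\<^sub>F y in nhds x. f y < ereal b))"
proof
  assume u: "upper_semicont f"
  show "\<forall>x b. f x < ereal b \<longrightarrow> (\<forall>\<^sub>F y in nhds x. f y < ereal b)"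
  proof (intro allI impI)
    fix x b assume b: "f x < ereal b"
    have "Limsup (at x) f < ereal b" using u b unfolding upper_semicont_def by (meson le_less_trans)
    then have "\<forall>\<^sub>F y in at x. f y < ereal b" by (rule Limsup_lessD)
    then show "\<forall>\<^sub>F y in nhds x. f y < ereal b"
      using b unfolding eventually_at_filter
      by (elim eventually_mono) auto
  qed
next
  assume *: "\<forall>x b. f x < ereal b \<longrightarrow> (\<forall>\<^sub>F y in nhds x. f y < ereal b)"
  show "upper_semicont f" unfolding upper_semicont_def
  proof (intro allI, rule ccontr)
    fix x assume "\<not> Limsup (at x) f \<le> f x"
    then obtain b where b: "f x < ereal b" "ereal b < Limsup (at x) f"
      using ereal_dense2 by (meson not_le)
    have "\<forall>\<^sub>F y in nhds x. f y < ereal b" using * b by blast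
    then have "\<forall>\<^sub>F y in at x. f y < ereal b" unfolding eventually_at_filter
      by (rule eventually_mono) simp
    then have "Limsup (at x) f \<le> ereal b"
      by (intro Limsup_bounded) (auto elim: eventually_mono)
    then show False using b by auto
  qed
qed

lemma upper_semicont_iff_closed_hypograph:
  fixes f :: "'a::topological_space \<Rightarrow> ereal"
  shows "upper_semicont f \<longleftrightarrow> closed (hypograph f)"
proof
  assume u: "upper_semicont f"
  show "closed (hypograph f)" unfolding closed_def
  proof (subst open_subopen, intro ballI)
    fix p assume p: "p \<in> - hypograph f"
    obtain x a where px: "p = (x, a)" by force
    then have "f x < ereal a" using p by auto
    then obtain b where b: "f x < ereal b" "ereal b < ereal a"
      using ereal_dense2[of "f x" "ereal a"] by blast
    have "\<forall>\<^sub>F y in nhds x. f y < ereal b"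
      using upper_semicont_iff_eventually[THEN iffD1, OF u] b(1) by simp
    then obtain U where U: "open U" "x \<in> U" "\<And>y. y \<in> U \<Longrightarrow> f y < ereal b"
      unfolding eventually_nhds by metis
    have "U \<times> {b<..} \<subseteq> - hypograph f"
    proof clarsimp
      fix y c assume "y \<in> U" "b < c" "ereal c \<le> f y"
      then have "ereal c < ereal b" using U(3) by (meson le_less_trans)
      then show False using \<open>b < c\<close> by simp
    qed
    moreover have "open (U \<times> {b<..})" "p \<in> U \<times> {b<..}"
      using U b px by (auto intro: open_Times)
    ultimately show "\<exists>T. open T \<and> p \<in> T \<and> T \<subseteq> - hypograph f" by blast
  qed
next
  assume c: "closed (hypograph f)"
  show "upper_semicont f" unfolding upper_semicont_iff_eventually
  proof (intro allI impI)
    fix x b assume "f x < ereal b"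
    then have "(x, b) \<in> - hypograph f" by auto
    moreover have "open (- hypograph f)" using c by auto
    ultimately obtain U V where UV: "open U" "open V" "x \<in> U" "b \<in> V" "U \<times> V \<subseteq> - hypograph f"
      by (metis open_prod_elim mem_Sigma_iff)
    show "\<forall>\<^sub>F y in nhds x. f y < ereal b"
      unfolding eventually_nhds using UV by (intro exI[of _ U]) (force simp: not_le)
  qed
qed

lemma coercive_iff_bounded_superlevel:
  fixes f :: "'a::real_normed_vector \<Rightarrow> ereal"
  shows "coercive f \<longleftrightarrow> (\<forall>a. bounded {x. ereal a \<le> f x})"
proof
  assume "coercive f"
  then have c: "\<And>a. \<forall>\<^sub>F x in at_infinity. f x < ereal a"
    unfolding coercive_def tendsto_MInfty by auto
  show "\<forall>a. bounded {x. ereal a \<le> f x}"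
  proof
    fix a
    obtain b where "\<And>x. b \<le> norm x \<Longrightarrow> f x < ereal a"
      using c[of a] unfolding eventually_at_infinity by auto
    then show "bounded {x. ereal a \<le> f x}"
      unfolding bounded_iff by (intro exI[of _ b]) (force simp: not_le[symmetric])
  qed
next
  assume b: "\<forall>a. bounded {x. ereal a \<le> f x}"
  show "coercive f" unfolding coercive_def tendsto_MInfty
  proof
    fix a
    obtain B where B: "\<And>x. ereal a \<le> f x \<Longrightarrow> norm x \<le> B"
      using b unfolding bounded_iff by (metis mem_Collect_eq)
    then show "\<forall>\<^sub>F x in at_infinity. f x < ereal a"
      unfolding eventually_at_infinity by (intro exI[of _ "B + 1"]) (force simp: not_le[symmetric])
  qed
qed

text \<open>
  The four conditions defining \<open>Phi\<close> in geometric form; all closure properties of \<open>Phi\<close> below are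
  read off from the hypograph.
\<close>

lemma Phi_iff_hypograph:
  "f \<in> Phi \<longleftrightarrow> (\<forall>x. f x \<noteq> \<infinity>) \<and> convex (hypograph f) \<and> closed (hypograph f)
      \<and> (\<forall>a. bounded {x. ereal a \<le> f x})"
  using concave_ereal_iff_convex_hypograph[of f]
  by (auto simp: Phi_def upper_semicont_iff_closed_hypograph coercive_iff_bounded_superlevel)

lemma convex_hypographD:
  assumes "convex (hypograph f)" "ereal a \<le> f x" "ereal b \<le> f y" "0 \<le> t" "t \<le> 1"
  shows "ereal ((1 - t) * a + t * b) \<le> f ((1 - t) *\<^sub>R x + t *\<^sub>R y)"
proof -
  have "(1 - t) *\<^sub>R (x, a) + t *\<^sub>R (y, b) \<in> hypograph f"
    using assms unfolding convex_alt by (meson mem_hypograph)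
  then show ?thesis by simp
qed

lemma closed_superlevel:
  fixes f :: "'a::t2_space \<Rightarrow> ereal"
  assumes "closed (hypograph f)"
  shows "closed {x. ereal a \<le> f x}"
proof -
  have "{x. ereal a \<le> f x} = (\<lambda>x. (x, a)) -` hypograph f" by auto
  then show ?thesis using assms by (auto intro!: closed_vimage continuous_intros)
qed

lemma convex_superlevel:
  assumes "convex (hypograph f)"
  shows "convex {x. ereal a \<le> f x}"
  unfolding convex_alt
proof (intro ballI allI impI, clarsimp)
  fix x y and t :: real
  assume "ereal a \<le> f x" "ereal a \<le> f y" "0 \<le> t" "t \<le> 1"
  from convex_hypographD[OF assms this] show "ereal a \<le> f ((1 - t) *\<^sub>R x + t *\<^sub>R y)"
    by (simp add: algebra_simps)
qed

lemma borel_measurable_closed_hypograph: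
  fixes f :: "'a::t2_space \<Rightarrow> ereal"
  assumes "closed (hypograph f)"
  shows "f \<in> borel_measurable borel"
proof (rule borel_measurableI_ge)
  fix y :: ereal
  have "{x. ereal a \<le> f x} \<in> sets borel" for a
    using closed_superlevel[OF assms] by (rule borel_closed)
  moreover have "{x. y \<le> f x} = (if y = -\<infinity> then UNIV else if y = \<infinity> then (\<Inter>n::nat. {x. ereal (real n) \<le> f x})
      else {x. ereal (real_of_ereal y) \<le> f x})"
  proof (cases y)
    case PInf
    have "f x = \<infinity>" if that: "\<forall>n. ereal (real n) \<le> f x" for x
    proof (cases "f x")
      case (real r)
      obtain n where "r < real n" using reals_Archimedean2 by blast
      with that[rule_format, of n] real show ?thesis by simp
    qed (use that[rule_format, of 0] in auto)
    then show ?thesis by (auto simp: PInf)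
  qed auto
  ultimately show "{x \<in> space borel. y \<le> f x} \<in> sets borel" by (auto simp del: ereal_infty_less_eq)
qed

text \<open>
  Coercivity makes \<open>f\<close> drop by 1 between a point \<open>x0\<close> of its domain and the sphere of some radius \<open>R\<close>
  about \<open>x0\<close>; by concavity it continues to drop at least at the rate \<open>1 / R\<close> outside the sphere. Inside,
  upper semicontinuity and compactness bound \<open>f\<close> from above.
\<close>

lemma Phi_linear_bound:
  fixes f :: "'a::euclidean_space \<Rightarrow> ereal"
  assumes f: "f \<in> Phi"
  obtains a b where "b > 0" "a \<ge> 0" "\<And>x. f x \<le> ereal (a - b * norm x)"
proof -
  have fin: "\<And>x. f x \<noteq> \<infinity>" and cv: "convex (hypograph f)" and cl: "closed (hypograph f)"
    and bd: "\<And>a. bounded {x. ereal a \<le> f x}"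
    using f by (auto simp: Phi_iff_hypograph)
  show ?thesis
  proof (cases "\<exists>x. f x \<noteq> -\<infinity>")
    case False
    then have "\<And>x. f x \<le> ereal (0 - 1 * norm x)" by auto
    then show ?thesis using that by (meson less_numeral_extra(1) order_refl)
  next
    case True
    then obtain x0 v where x0: "f x0 = ereal v" using fin by (metis ereal_cases uminus_ereal.simps(2))
    obtain R where R: "R > 0" "\<And>x. ereal (v - 1) \<le> f x \<Longrightarrow> dist x0 x < R"
    proof -
      obtain R where "{x. ereal (v - 1) \<le> f x} \<subseteq> ball x0 R"
        using bounded_subset_ballD[OF bd] by blast
      then show ?thesis using that[of "max R 1"] by fastforce
    qed
    have far: "f x \<le> ereal (v - dist x0 x / R)" if "dist x0 x \<ge> R" for x
    proof (rule ereal_le_if_real_le)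
      fix c assume c: "ereal c \<le> f x"
      \<comment> \<open>With this \<open>s\<close> the convex combination \<open>?y\<close> of \<open>x0\<close> and \<open>x\<close> lies on the sphere of radius \<open>R\<close>.\<close>
      define s where "s = R / dist x0 x"
      have d: "dist x0 x > 0" using that R by linarith
      then have s: "0 < s" "s \<le> 1" using that R(1) by (auto simp: s_def)
      let ?y = "(1 - s) *\<^sub>R x0 + s *\<^sub>R x"
      have "dist x0 ?y = R"
      proof -
        have "x0 - ?y = s *\<^sub>R (x0 - x)" by (simp add: algebra_simps)
        then have "dist x0 ?y = s * dist x0 x" using s by (simp add: dist_norm)
        then show ?thesis using d by (simp add: s_def)
      qed
      then have "f ?y < ereal (v - 1)" using R(2)[of ?y] by force
      moreover have "ereal ((1 - s) * v + s * c) \<le> f ?y"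
        by (rule convex_hypographD[OF cv]) (use x0 c s in auto)
      ultimately have "(1 - s) * v + s * c < v - 1"
        by (metis ereal_less(1) le_less_trans less_ereal.simps(1))
      then have "s * c < s * v - 1" by (simp add: algebra_simps)
      then have "c < v - 1 / s" using s by (simp add: field_simps)
      then show "ereal c \<le> ereal (v - dist x0 x / R)" by (simp add: s_def)
    qed
    \<comment> \<open>If \<open>f\<close> were unbounded on the ball, the finite intersection property of the closed superlevel sets
      would produce a point with value \<open>\<infinity>\<close>.\<close>
    have "\<exists>B. \<forall>x\<in>cball x0 R. f x \<le> ereal B"
    proof (rule ccontr)
      assume "\<not> ?thesis"
      then have ne: "cball x0 R \<inter> {x. ereal B \<le> f x} \<noteq> {}" for B
        by (metis (mono_tags, lifting) disjoint_iff linorder_linear mem_Collect_eq)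
      have "cball x0 R \<inter> (\<Inter>n::nat. {x. ereal (real n) \<le> f x}) \<noteq> {}"
      proof (rule compact_imp_fip_image[OF compact_cball])
        show "closed {x. ereal (real n) \<le> f x}" for n :: nat using closed_superlevel[OF cl] .
        fix I :: "nat set" assume "finite I" "I \<subseteq> UNIV"
        then obtain N where "\<And>i. i \<in> I \<Longrightarrow> i \<le> N" by (meson finite_nat_set_iff_bounded_le)
        then have "{x. ereal (real N) \<le> f x} \<subseteq> (\<Inter>n\<in>I. {x. ereal (real n) \<le> f x})"
          by (auto intro: order_trans[rotated])
        then show "cball x0 R \<inter> (\<Inter>n\<in>I. {x. ereal (real n) \<le> f x}) \<noteq> {}"
          using ne[of "real N"] by blast
      qed
      then obtain x where x: "\<And>n::nat. ereal (real n) \<le> f x" by auto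
      show False
      proof (cases "f x")
        case (real r)
        obtain n where "r < real n" using reals_Archimedean2 by blast
        with x[of n] real show False by simp
      qed (use x[of 0] fin in auto)
    qed
    then obtain B where B: "\<And>x. dist x0 x \<le> R \<Longrightarrow> f x \<le> ereal B" by (metis mem_cball)
    have "f x \<le> ereal ((\<bar>v\<bar> + \<bar>B\<bar> + 1 + norm x0 / R) - (1/R) * norm x)" for x
    proof (cases "dist x0 x \<le> R")
      case True
      have "norm x \<le> norm x0 + R" using True by (metis add_left_mono dist_norm norm_minus_commute norm_triangle_sub order_trans)
      then have "norm x / R \<le> norm x0 / R + 1" using R(1) by (simp add: field_simps)
      then have "B \<le> (\<bar>v\<bar> + \<bar>B\<bar> + 1 + norm x0 / R) - (1/R) * norm x" by (simp add: field_simps)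
      then show ?thesis using B[OF True] by (meson ereal_less_eq(3) order_trans)
    next
      case False
      have "norm x \<le> norm x0 + dist x0 x" by (metis dist_norm norm_minus_commute norm_triangle_sub)
      then have "norm x / R \<le> norm x0 / R + dist x0 x / R" using R(1) by (simp add: field_simps)
      then have "v - dist x0 x / R \<le> (\<bar>v\<bar> + \<bar>B\<bar> + 1 + norm x0 / R) - (1/R) * norm x" by (simp add: field_simps)
      then show ?thesis using far[of x] False by (meson ereal_less_eq(3) order_trans linear)
    qed
    then show ?thesis using that[of "1/R" "\<bar>v\<bar> + \<bar>B\<bar> + 1 + norm x0 / R"] R(1) by (simp add: add_nonneg_nonneg)
  qed
qed

section \<open>Integrability of exponentially decaying functions\<close>

text \<open>
  The integrand is dominated by \<open>1 / c\<close> times the sum of an exponential density and its reflection.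
\<close>

lemma nn_integral_exp_neg_abs_finite:
  assumes c: "c > 0"
  shows "(\<integral>\<^sup>+t. ennreal (exp (- c * \<bar>t\<bar>)) \<partial>lborel) < \<infinity>"
proof -
  let ?d = "\<lambda>t. ennreal (exponential_density c t)"
  interpret E: prob_space "density lborel (exponential_density c)"
    using c by (rule prob_space_exponential_density)
  have 1: "(\<integral>\<^sup>+t. ?d t \<partial>lborel) = 1"
    using E.emeasure_space_1 by (simp add: emeasure_density)
  have 2: "(\<integral>\<^sup>+t. ?d (- t) \<partial>lborel) = 1"
    using nn_integral_real_affine[of ?d "-1" 0] 1 by simp
  have "(\<integral>\<^sup>+t. ennreal (exp (- c * \<bar>t\<bar>)) \<partial>lborel) \<le> (\<integral>\<^sup>+t. ennreal (1/c) * (?d t + ?d (- t)) \<partial>lborel)"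
  proof (rule nn_integral_mono)
    fix t :: real
    have "exp (- c * \<bar>t\<bar>) \<le> (1/c) * (exponential_density c t + exponential_density c (- t))"
      using c by (auto simp: exponential_density_def abs_if field_simps)
    moreover have "0 \<le> exponential_density c t" "0 \<le> exponential_density c (- t)"
      using c by (auto simp: exponential_density_def)
    ultimately show "ennreal (exp (- c * \<bar>t\<bar>)) \<le> ennreal (1/c) * (?d t + ?d (- t))"
      using c by (simp add: ennreal_mult[symmetric] ennreal_plus[symmetric] ennreal_leI del: ennreal_plus)
  qed
  also have "\<dots> = ennreal (1/c) * (1 + 1)"
    by (simp add: nn_integral_cmult nn_integral_add 1 2)
  also have "\<dots> < \<infinity>" by (simp add: ennreal_mult_less_top)
  finally show ?thesis .
qed

text \<open>
  The norm is at least the mean of the absolute values of the coordinates, so the integrand is dominated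
  by a product of one-dimensional functions and the integral factorizes.
\<close>

lemma nn_integral_exp_neg_norm_finite:
  assumes b: "b > 0"
  shows "(\<integral>\<^sup>+x. ennreal (exp (a - b * norm x)) \<partial>(lborel :: 'a::euclidean_space measure)) < \<infinity>"
proof -
  let ?c = "b / DIM('a)"
  have c: "?c > 0" using b by simp
  have "(\<integral>\<^sup>+x. ennreal (exp (a - b * norm x)) \<partial>(lborel :: 'a measure))
      \<le> (\<integral>\<^sup>+x. ennreal (exp a) * (\<Prod>i\<in>Basis. ennreal (exp (- ?c * \<bar>x \<bullet> i\<bar>))) \<partial>(lborel :: 'a measure))"
  proof (rule nn_integral_mono)
    fix x :: 'a
    have "(\<Sum>i\<in>Basis. \<bar>x \<bullet> i\<bar>) \<le> (\<Sum>i\<in>(Basis::'a set). norm x)"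
      by (intro sum_mono Basis_le_norm)
    then have "?c * (\<Sum>i\<in>Basis. \<bar>x \<bullet> i\<bar>) \<le> ?c * (DIM('a) * norm x)"
      using c by (intro mult_left_mono) auto
    then have "exp (a - b * norm x) \<le> exp (a + (\<Sum>i\<in>Basis. - ?c * \<bar>x \<bullet> i\<bar>))"
      by (simp add: sum_distrib_left[symmetric] sum_negf sum_divide_distrib[symmetric])
    also have "\<dots> = exp a * (\<Prod>i\<in>Basis. exp (- ?c * \<bar>x \<bullet> i\<bar>))"
      by (simp only: exp_add exp_sum finite_Basis)
    finally show "ennreal (exp (a - b * norm x)) \<le> ennreal (exp a) * (\<Prod>i\<in>Basis. ennreal (exp (- ?c * \<bar>x \<bullet> i\<bar>)))"
      by (subst prod_ennreal) (auto simp: ennreal_mult[symmetric] prod_nonneg intro!: ennreal_leI)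
  qed
  also have "\<dots> = ennreal (exp a) * (\<Prod>i\<in>(Basis::'a set). (\<integral>\<^sup>+t. ennreal (exp (- ?c * \<bar>t\<bar>)) \<partial>lborel))"
  proof -
    have "(\<integral>\<^sup>+x. (\<Prod>i\<in>Basis. ennreal (exp (- ?c * \<bar>x \<bullet> i\<bar>))) \<partial>(lborel :: 'a measure))
        = (\<Prod>i\<in>(Basis::'a set). (\<integral>\<^sup>+t. ennreal (exp (- ?c * \<bar>t\<bar>)) \<partial>lborel))"
      by (rule nn_integral_lborel_prod) auto
    then show ?thesis by (subst nn_integral_cmult) auto
  qed
  also have "\<dots> < \<infinity>"
    using nn_integral_exp_neg_abs_finite[OF c] by (auto simp: ennreal_mult_less_top power_less_top_ennreal)
  finally show ?thesis .
qed

section \<open>The convex support of a probability measure\<close>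

locale borel_prob_space = prob_space Q for Q :: "'a::euclidean_space measure" +
  assumes sets_Q [measurable_cong]: "sets Q = sets borel"
begin

lemma space_Q [simp]: "space Q = UNIV"
  using sets_eq_imp_space_eq[OF sets_Q] by simp

lemma closed_csupp: "closed (csupp Q)" and convex_csupp: "convex (csupp Q)"
  by (auto simp: csupp_def intro!: closed_Inter convex_Inter)

lemma csupp_subset: "csupp Q \<subseteq> C" if "closed C" "convex C" "AE x in Q. x \<in> C"
proof -
  have "C \<in> events" using that by (simp add: sets_Q)
  then have "emeasure Q C = 1" using AE_in_set_eq_1[of C] that by (simp add: emeasure_eq_measure)
  then show ?thesis using that by (auto simp: csupp_def)
qed

text \<open>
  The convex support is an intersection of possibly uncountably many sets of full measure; by the
  Lindelof property countably many of them have the same intersection.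
\<close>

lemma AE_in_csupp: "AE x in Q. x \<in> csupp Q"
proof -
  define F where "F = {C. closed C \<and> convex C \<and> emeasure Q C = 1}"
  obtain G where G: "G \<subseteq> uminus ` F" "countable G" "\<Union>G = \<Union>(uminus ` F)"
  proof (rule Lindelof)
    show "open S" if "S \<in> uminus ` F" for S using that by (auto simp: F_def)
  qed
  have "AE x in Q. \<forall>S\<in>G. x \<notin> S"
  proof (subst AE_ball_countable[OF G(2)], intro ballI)
    fix S assume "S \<in> G"
    then obtain C where C: "S = - C" "closed C" "emeasure Q C = 1" using G(1) by (auto simp: F_def)
    then have "C \<in> events" by (simp add: sets_Q)
    then have "AE x in Q. x \<in> C" using C by (simp add: AE_in_set_eq_1 emeasure_eq_measure)
    then show "AE x in Q. x \<notin> S" using C by simp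
  qed
  then show ?thesis
  proof (rule AE_mp, intro AE_I2 impI)
    fix x assume "\<forall>S\<in>G. x \<notin> S"
    then have "x \<notin> \<Union>(uminus ` F)" using G(3) by blast
    then show "x \<in> csupp Q" by (auto simp: csupp_def F_def)
  qed
qed

text \<open>
  For each unit vector \<open>u\<close>, the open half-space of points at height more than \<open>r\<close> over \<open>z\<close> in direction
  \<open>u\<close> has positive probability, since otherwise its complement would contain the convex support. This
  probability is bounded below, uniformly in \<open>u\<close>, by a continuous function on the compact sphere, whose
  minimum is \<open>\<delta>\<close>. A closed convex set that misses a point of \<open>cball z r\<close> is separated from it by a
  hyperplane, hence misses one of these half-spaces and has probability at most \<open>1 - \<delta>\<close>.
\<close>

lemma convex_contains_ball_of_large_prob:
  assumes z: "z \<in> interior (csupp Q)"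
  obtains r \<delta> where "r > 0" "\<delta> > 0" "\<delta> \<le> 1"
    "\<And>C. \<lbrakk>closed C; convex C; prob C > 1 - \<delta>\<rbrakk> \<Longrightarrow> cball z r \<subseteq> C"
proof -
  obtain R where R: "R > 0" "cball z R \<subseteq> csupp Q"
    using z by (auto simp: mem_interior_cball)
  \<comment> \<open>The half-spaces must cut into \<open>cball z R\<close>, which is part of the convex support; any radius
    between 0 and \<open>R\<close> achieves this.\<close>
  define r where "r = R / 2"
  have r: "r > 0" using R by (simp add: r_def)
  \<comment> \<open>A truncated height function: a continuous minorant of the indicator of the half-space.\<close>
  define g where "g u y = min 1 (max 0 (u \<bullet> (y - z) - r))" for u y :: 'a
  define f where "f u = (\<integral>y. g u y \<partial>Q)" for u
  have g01: "0 \<le> g u y" "g u y \<le> 1" for u y by (auto simp: g_def)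
  have gm [measurable]: "g u \<in> borel_measurable Q" for u
    unfolding g_def by measurable
  have gi: "integrable Q (g u)" for u
    by (rule integrable_const_bound[of _ 1]) (use g01 in auto)
  have cont: "continuous_on (sphere 0 1) f"
    unfolding continuous_on_sequentially
  proof (intro allI ballI impI, elim conjE)
    fix u :: "nat \<Rightarrow> 'a" and v assume uv: "u \<longlonglongrightarrow> v"
    show "(f \<circ> u) \<longlonglongrightarrow> f v"
      unfolding f_def o_def
      by (rule integral_dominated_convergence[where w = "\<lambda>_. 1"])
        (use g01 uv in \<open>auto simp: g_def intro!: tendsto_intros\<close>)
  qed
  obtain u0 where u0: "norm u0 = 1" "\<And>u. norm u = 1 \<Longrightarrow> f u0 \<le> f u"
  proof -
    have ne: "sphere (0::'a) 1 \<noteq> {}" by simp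
    show ?thesis using continuous_attains_inf[OF compact_sphere ne cont] that by auto
  qed
  have fpos: "f u > 0" if u: "norm u = 1" for u
  proof (rule ccontr)
    assume "\<not> f u > 0"
    moreover have "f u \<ge> 0" unfolding f_def by (rule Bochner_Integration.integral_nonneg) (rule g01)
    ultimately have "f u = 0" by simp
    then have "AE y in Q. g u y = 0"
      unfolding f_def using integral_nonneg_eq_0_iff_AE[OF gi] g01 by auto
    then have "AE y in Q. y \<in> {y. u \<bullet> y \<le> r + u \<bullet> z}"
      by (rule AE_mp) (auto simp: g_def inner_diff_right min_def max_def split: if_splits)
    then have "csupp Q \<subseteq> {y. u \<bullet> y \<le> r + u \<bullet> z}"
      by (intro csupp_subset closed_halfspace_le convex_halfspace_le)
    moreover have "z + R *\<^sub>R u \<in> csupp Q" using R u by (intro set_mp[OF R(2)]) (auto simp: dist_norm)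
    ultimately have "u \<bullet> (z + R *\<^sub>R u) \<le> r + u \<bullet> z" by auto
    then have "R \<le> r" using u by (simp add: inner_add_right dot_square_norm)
    then show False using R by (simp add: r_def)
  qed
  have f1: "f u \<le> 1" for u
    using integral_mono[OF gi[of u], of "\<lambda>_. 1"] g01 prob_space by (simp add: f_def)
  have fprob: "f u \<le> prob {y. u \<bullet> (y - z) > r}" for u
  proof -
    have [measurable]: "{y. u \<bullet> (y - z) > r} \<in> events" by measurable
    have "integrable Q (indicator {y. u \<bullet> (y - z) > r} :: _ \<Rightarrow> real)"
      by (rule integrable_real_indicator) (auto simp: emeasure_eq_measure)
    then have "f u \<le> (\<integral>y. indicator {y. u \<bullet> (y - z) > r} y \<partial>Q)"
      unfolding f_def by (rule integral_mono[OF gi]) (auto simp: g_def indicator_def min_def max_def)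
    then show ?thesis by simp
  qed
  show ?thesis
  proof (rule that[of r "f u0"])
    show "r > 0" by fact
    show "f u0 > 0" using fpos u0 by auto
    show "f u0 \<le> 1" by fact
    fix C assume C: "closed C" "convex C" "prob C > 1 - f u0"
    have Cne: "C \<noteq> {}" using C(3) f1[of u0] by force
    show "cball z r \<subseteq> C"
    proof (rule ccontr)
      assume "\<not> cball z r \<subseteq> C"
      then obtain x where x: "x \<in> cball z r" "x \<notin> C" by blast
      obtain a b where ab: "a \<bullet> x < b" "\<And>y. y \<in> C \<Longrightarrow> a \<bullet> y > b"
        using separating_hyperplane_closed_point[OF C(2,1) x(2)] by blast
      have a0: "a \<noteq> 0" using ab Cne by force
      define u where "u = (- 1 / norm a) *\<^sub>R a"
      have u: "norm u = 1" using a0 by (simp add: u_def)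
      have [measurable]: "{y. u \<bullet> (y - z) > r} \<in> events" "C \<in> events" using C(1) by (auto simp: sets_Q intro: borel_closed) measurable
      have "C \<inter> {y. u \<bullet> (y - z) > r} = {}"
      proof safe
        fix y assume y: "y \<in> C" "u \<bullet> (y - z) > r"
        have "a \<bullet> (y - x) > 0" using ab(1) ab(2)[OF y(1)] by (simp add: inner_diff_right)
        then have "u \<bullet> (y - x) < 0" using a0 by (simp add: u_def divide_neg_pos)
        moreover have "u \<bullet> (x - z) \<le> r"
          using norm_cauchy_schwarz[of u "x - z"] u x(1) by (simp add: dist_norm norm_minus_commute)
        moreover have "u \<bullet> (y - z) = u \<bullet> (y - x) + u \<bullet> (x - z)" by (simp add: inner_diff_right)
        ultimately show "y \<in> {}" using y(2) by simp
      qed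
      then have "prob C + prob {y. u \<bullet> (y - z) > r} = prob (C \<union> {y. u \<bullet> (y - z) > r})"
        by (intro finite_measure_Union[symmetric]) auto
      also have "\<dots> \<le> 1" by simp
      finally show False using C(3) u0(2)[OF u] fprob[of u] by simp
    qed
  qed
qed

end

section \<open>The maximization problem as a minimization of a nonnegative cost\<close>

lemma exp_ereal_simps [simp]:
  "exp_ereal (ereal r) = ennreal (exp r)" "exp_ereal (-\<infinity>) = 0" "exp_ereal \<infinity> = \<infinity>"
  by (simp_all add: exp_ereal_def)

lemma exp_ereal_mono: "x \<le> y \<Longrightarrow> exp_ereal x \<le> exp_ereal y"
  by (cases x; cases y) (auto intro!: ennreal_leI)

lemma borel_measurable_exp_ereal [measurable]: "exp_ereal \<in> borel_measurable borel"
proof -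
  have "exp_ereal = (\<lambda>x. if x = -\<infinity> then 0 else if x = \<infinity> then \<infinity> else ennreal (exp (real_of_ereal x)))"
  proof
    fix x show "exp_ereal x = (if x = -\<infinity> then 0 else if x = \<infinity> then \<infinity> else ennreal (exp (real_of_ereal x)))"
      by (cases x) auto
  qed
  then show ?thesis by (rule ssubst) measurable
qed

lemma borel_measurable_Phi: "f \<in> Phi \<Longrightarrow> f \<in> borel_measurable borel"
  by (auto simp: Phi_iff_hypograph intro: borel_measurable_closed_hypograph)

lemma nn_integral_exp_Phi_finite:
  fixes f :: "'a::euclidean_space \<Rightarrow> ereal"
  assumes "f \<in> Phi"
  shows "(\<integral>\<^sup>+x. exp_ereal (f x) \<partial>lborel) < \<infinity>"
proof -
  obtain a b where ab: "b > 0" "\<And>x. f x \<le> ereal (a - b * norm x)"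
    using Phi_linear_bound[OF assms] by blast
  have "(\<integral>\<^sup>+x. exp_ereal (f x) \<partial>lborel) \<le> (\<integral>\<^sup>+x. ennreal (exp (a - b * norm x)) \<partial>(lborel :: 'a measure))"
    using exp_ereal_mono[OF ab(2)] by (intro nn_integral_mono) simp
  also have "\<dots> < \<infinity>" by (rule nn_integral_exp_neg_norm_finite[OF ab(1)])
  finally show ?thesis .
qed

text \<open>
  The homothety with centre \<open>x\<close> and ratio \<open>s\<close> maps \<open>cball z r\<close> onto the ball of radius \<open>s * r\<close> about
  the image of \<open>z\<close>. A bound for a concave function at \<open>x\<close> and on \<open>cball z r\<close> thereby spreads to the smaller balls.
\<close>

lemma cball_combinationE:
  fixes x z w :: "'a::real_normed_vector"
  assumes s: "0 < s" and w: "w \<in> cball ((1 - s) *\<^sub>R x + s *\<^sub>R z) (s * r)"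
  obtains y where "y \<in> cball z r" "w = (1 - s) *\<^sub>R x + s *\<^sub>R y"
proof -
  let ?c = "(1 - s) *\<^sub>R x + s *\<^sub>R z"
  let ?y = "z + (1 / s) *\<^sub>R (w - ?c)"
  have "norm (w - ?c) \<le> s * r" using w by (simp add: dist_norm norm_minus_commute)
  moreover have "dist z ?y = norm (w - ?c) / s"
    using s by (simp only: dist_norm norm_minus_commute[of z] add_diff_cancel_left' norm_scaleR) simp
  ultimately have "?y \<in> cball z r" using s by (simp add: pos_divide_le_eq mult.commute)
  moreover have "w = (1 - s) *\<^sub>R x + s *\<^sub>R ?y" using s by (simp add: algebra_simps)
  ultimately show ?thesis using that by blast
qed

context borel_prob_space
begin

definition cost :: "real \<Rightarrow> ('a \<Rightarrow> ereal) \<Rightarrow> ennreal" where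
  "cost M f = (\<integral>\<^sup>+x. e2ennreal (ereal M - f x) \<partial>Q) + (\<integral>\<^sup>+x. exp_ereal (f x) \<partial>lborel)"

lemma emeasure_Q_UNIV [simp]: "emeasure Q UNIV = 1"
  using emeasure_space_1 by simp

text \<open>
  With an upper bound \<open>M \<ge> 0\<close>, the negative part of \<open>f\<close> can be exchanged for the nonnegative function
  \<open>M - f\<close>, because \<open>f\<^sup>+ + (M - f) = M + f\<^sup>-\<close> and the integral of \<open>f\<^sup>+\<close> is finite.
\<close>

lemma ext_integral_bounded_above:
  assumes [measurable]: "f \<in> borel_measurable borel" and le: "\<And>x. f x \<le> ereal M" and M: "M \<ge> 0"
  shows "ext_integral Q f = ereal M - enn2ereal (\<integral>\<^sup>+x. e2ennreal (ereal M - f x) \<partial>Q)"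
proof -
  let ?A = "\<integral>\<^sup>+x. e2ennreal (f x) \<partial>Q" and ?B = "\<integral>\<^sup>+x. e2ennreal (- f x) \<partial>Q"
  let ?N = "\<integral>\<^sup>+x. e2ennreal (ereal M - f x) \<partial>Q"
  have [measurable]: "f \<in> borel_measurable Q" by simp
  have pt: "e2ennreal (f x) + e2ennreal (ereal M - f x) = ennreal M + e2ennreal (- f x)" for x
  proof (cases "f x")
    case (real r)
    then have "r \<le> M" using le[of x] by simp
    then show ?thesis using real M
      by (cases "r \<ge> 0") (auto simp: ennreal_neg ennreal_plus[symmetric] simp del: ennreal_plus)
  qed (use le[of x] in \<open>auto simp: e2ennreal_neg\<close>)
  have "?A + ?N = (\<integral>\<^sup>+x. e2ennreal (f x) + e2ennreal (ereal M - f x) \<partial>Q)"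
    by (intro nn_integral_add[symmetric]) measurable
  also have "\<dots> = (\<integral>\<^sup>+x. ennreal M + e2ennreal (- f x) \<partial>Q)" by (simp add: pt)
  also have "\<dots> = ennreal M + ?B"
    by (subst nn_integral_add) auto
  finally have eq: "?A + ?N = ennreal M + ?B" .
  have "?A \<le> (\<integral>\<^sup>+x. ennreal M \<partial>Q)"
    using e2ennreal_mono[OF le] by (intro nn_integral_mono) simp
  then have A: "?A \<le> ennreal M" by simp
  then obtain a where a: "?A = ennreal a" "a \<ge> 0" by (cases ?A) (auto simp: top_unique)
  show ?thesis
  proof (cases ?N)
    case (real n)
    then have "ennreal M + ?B < top" using eq[symmetric] a by simp
    then obtain b where b: "?B = ennreal b" "b \<ge> 0" by (cases ?B) auto
    have "a + n = M + b" using eq real a b M by (simp flip: ennreal_plus)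
    then show ?thesis unfolding ext_integral_def using a b real by simp
  next
    case top
    then have "ennreal M + ?B = top" using eq by simp
    then have "?B = top" unfolding ennreal_add_eq_top by simp
    then show ?thesis unfolding ext_integral_def using a top by simp
  qed
qed

lemma L_fun_eq_cost:
  assumes "f \<in> borel_measurable borel" "\<And>x. f x \<le> ereal M" "M \<ge> 0"
  shows "L_fun f Q = ereal (M + 1) - enn2ereal (cost M f)"
  unfolding L_fun_def ext_integral_bounded_above[OF assms] cost_def
  by (cases "\<integral>\<^sup>+x. e2ennreal (ereal M - f x) \<partial>Q"; cases "\<integral>\<^sup>+x. exp_ereal (f x) \<partial>lborel")
     (auto simp flip: ennreal_plus simp: plus_ennreal.rep_eq)

lemma Phi_bounded_above:
  assumes "f \<in> Phi"
  obtains M where "M \<ge> 0" "\<And>x. f x \<le> ereal M"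
proof -
  obtain a b where ab: "b > 0" "a \<ge> 0" "\<And>x. f x \<le> ereal (a - b * norm x)"
    using Phi_linear_bound[OF assms] by blast
  have "f x \<le> ereal a" for x
  proof -
    have "a - b * norm x \<le> a" using ab(1) by simp
    then show ?thesis using ab(3)[of x] by (meson ereal_less_eq(3) order_trans)
  qed
  then show ?thesis using that ab(2) by blast
qed

section \<open>Uniform bounds for near-maximizers\<close>

text \<open>
  With probability at least \<open>\<delta>\<close> the function is below \<open>- K\<close>, which costs at least \<open>M + K\<close> there.
\<close>

lemma L_fun_le_if_small_superlevel:
  assumes f: "f \<in> borel_measurable borel" and le: "\<And>x. f x \<le> ereal M" "M \<ge> 0" and K: "- K \<le> M"
    and p: "prob {x. ereal (- K) \<le> f x} \<le> 1 - \<delta>" and d: "\<delta> \<ge> 0"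
  shows "L_fun f Q \<le> ereal (M + 1 - (M + K) * \<delta>)"
proof -
  let ?S = "{x. \<not> ereal (- K) \<le> f x}"
  have [measurable]: "f \<in> borel_measurable Q" using f by simp
  have S [measurable]: "?S \<in> events" by measurable
  have "?S = space Q - {x. ereal (- K) \<le> f x}" by auto
  then have "prob ?S = 1 - prob {x. ereal (- K) \<le> f x}"
    by (simp only:) (rule prob_compl, measurable)
  then have pS: "\<delta> \<le> prob ?S" using p by simp
  have "ennreal ((M + K) * \<delta>) \<le> ennreal (M + K) * emeasure Q ?S"
    using K d pS by (simp add: emeasure_eq_measure ennreal_mult[symmetric] mult_left_mono ennreal_leI)
  also have "\<dots> = (\<integral>\<^sup>+x. ennreal (M + K) * indicator ?S x \<partial>Q)"
    by (rule nn_integral_cmult_indicator[symmetric]) simp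
  also have "\<dots> \<le> (\<integral>\<^sup>+x. e2ennreal (ereal M - f x) \<partial>Q)"
  proof (rule nn_integral_mono)
    fix x
    show "ennreal (M + K) * indicator ?S x \<le> e2ennreal (ereal M - f x)"
    proof (cases "x \<in> ?S")
      case True
      then have "ereal (M + K) \<le> ereal M - f x" by (cases "f x") auto
      then show ?thesis using e2ennreal_mono[of "ereal (M + K)"] True by simp
    qed simp
  qed
  also have "\<dots> \<le> cost M f" by (simp add: cost_def)
  finally have "ennreal ((M + K) * \<delta>) \<le> cost M f" .
  then have "ereal ((M + K) * \<delta>) \<le> enn2ereal (cost M f)"
    using K d by (cases "cost M f") (auto simp: ennreal_le_iff)
  then show ?thesis unfolding L_fun_eq_cost[OF f le]
    by (cases "enn2ereal (cost M f)") auto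
qed

text \<open>
  The lower bound on the ball makes the Lebesgue integral of \<open>exp f\<close> large.
\<close>

lemma L_fun_le_if_ge_on_cball:
  assumes f: "f \<in> borel_measurable borel" and le: "\<And>x. f x \<le> ereal M" "M \<ge> 0"
    and ge: "\<And>y. y \<in> cball c \<rho> \<Longrightarrow> ereal b \<le> f y" and rho: "\<rho> \<ge> 0"
  shows "L_fun f Q \<le> ereal (M + 1 - measure lborel (cball c \<rho>) * exp b)"
proof -
  have e: "emeasure lborel (cball c \<rho>) = ennreal (measure lborel (cball c \<rho>))"
    by (intro emeasure_eq_ennreal_measure) (use emeasure_lborel_cball_finite[of c \<rho>] in \<open>auto simp: less_top\<close>)
  have "ennreal (measure lborel (cball c \<rho>) * exp b) = (\<integral>\<^sup>+x. ennreal (exp b) * indicator (cball c \<rho>) x \<partial>lborel)"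
    by (simp add: nn_integral_cmult_indicator e ennreal_mult[symmetric] mult.commute)
  also have "\<dots> \<le> (\<integral>\<^sup>+x. exp_ereal (f x) \<partial>lborel)"
    using exp_ereal_mono[OF ge] by (intro nn_integral_mono) (auto simp: indicator_def)
  also have "\<dots> \<le> cost M f" by (simp add: cost_def)
  finally have "ennreal (measure lborel (cball c \<rho>) * exp b) \<le> cost M f" .
  then have "ereal (measure lborel (cball c \<rho>) * exp b) \<le> enn2ereal (cost M f)"
    by (cases "cost M f") (auto simp: ennreal_le_iff)
  then show ?thesis unfolding L_fun_eq_cost[OF f le]
    by (cases "enn2ereal (cost M f)") auto
qed

text \<open>
  Upper bound: suppose that \<open>f\<close> has supremum \<open>m\<close>, and compare the superlevel set at \<open>- K\<close>, where \<open>K\<close> is a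
  large multiple of \<open>m\<close>, with the ball around \<open>z\<close>. If the set has probability at most \<open>1 - \<delta>\<close>, then
  \<open>L_fun f Q\<close> is at most about \<open>- m\<close>. Otherwise the set contains the ball, and by concavity \<open>f\<close> is at least
  \<open>m / 2 - 1\<close> on a ball whose radius does not depend on \<open>f\<close>; then \<open>L_fun f Q\<close> is at most
  \<open>m + 1 - V * exp (m / 2 - 1)\<close>. Both bounds tend to \<open>-\<infinity>\<close> as \<open>m\<close> grows.
  
  Lower bound: once the upper bound \<open>M\<close> is known, a value below \<open>- K\<close> in \<open>cball z r\<close> excludes the second
  case, and the first one is impossible for large \<open>K\<close>.
\<close>

lemma Phi_uniform_bounds:
  assumes z: "z \<in> interior (csupp Q)"
  obtains r M K where "r > 0" "M \<ge> 0"
    "\<And>f x. \<lbrakk>f \<in> Phi; L_fun f Q \<ge> ereal (- C)\<rbrakk> \<Longrightarrow> f x \<le> ereal M"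
    "\<And>f x. \<lbrakk>f \<in> Phi; L_fun f Q \<ge> ereal (- C); x \<in> cball z r\<rbrakk> \<Longrightarrow> ereal (- K) \<le> f x"
proof -
  obtain r \<delta> where r: "r > 0" and d: "\<delta> > 0" "\<delta> \<le> 1"
    and large: "\<And>C. \<lbrakk>closed C; convex C; prob C > 1 - \<delta>\<rbrakk> \<Longrightarrow> cball z r \<subseteq> C"
    using convex_contains_ball_of_large_prob[OF z] by metis
  have dichotomy: "prob {x. ereal (- K) \<le> f x} \<le> 1 - \<delta> \<or> (\<forall>x\<in>cball z r. ereal (- K) \<le> f x)"
    if "f \<in> Phi" for f K
  proof -
    have "closed {x. ereal (- K) \<le> f x}" "convex {x. ereal (- K) \<le> f x}"
      using that by (auto simp only: Phi_iff_hypograph intro: closed_superlevel convex_superlevel)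
    then have "cball z r \<subseteq> {x. ereal (- K) \<le> f x}" if "\<not> prob {x. ereal (- K) \<le> f x} \<le> 1 - \<delta>"
      using that by (intro large) simp_all
    then show ?thesis by blast
  qed
  \<comment> \<open>Chosen such that \<open>s * (m + K) = m / 2\<close> for \<open>K = 2 / \<delta> * m\<close>: the convex combination with weight \<open>s\<close>
    of the peak value and \<open>- K\<close> loses only half of the height.\<close>
  define s where "s = 1 / (2 * (1 + 2 / \<delta>))"
  have s: "0 < s" "s \<le> 1" using d by (auto simp: s_def field_simps add_pos_pos)
  define V where "V = measure lborel (cball (0::'a) (s * r))"
  have V: "V > 0" using s r by (simp add: V_def content_cball_pos)
  have "filterlim (\<lambda>m. m + 1 - V * exp (m / 2 - 1)) at_bot at_top"
    using V by real_asymp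
  then have "\<forall>\<^sub>F m in at_top. m + 1 - V * exp (m / 2 - 1) < - C"
    by (simp add: filterlim_at_bot_dense)
  then obtain M0 where M0: "\<And>m. m \<ge> M0 \<Longrightarrow> m + 1 - V * exp (m / 2 - 1) < - C"
    unfolding eventually_at_top_linorder by auto
  \<comment> \<open>The term \<open>C + 2\<close> ensures \<open>1 - m < - C\<close> for \<open>m > M\<close>, for the case of a superlevel set of small
    probability.\<close>
  define M where "M = max 0 (max M0 (C + 2))"
  have M: "M \<ge> 0" "M \<ge> M0" "M \<ge> C + 2" by (auto simp: M_def)
  have upper: "f x \<le> ereal M" if f: "f \<in> Phi" and L: "L_fun f Q \<ge> ereal (- C)" for f x
  proof (rule ccontr)
    assume "\<not> f x \<le> ereal M"
    then have x: "f x > ereal M" by simp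
    have fm: "f \<in> borel_measurable borel" using f by (rule borel_measurable_Phi)
    have cv: "convex (hypograph f)" and fin: "\<And>x. f x \<noteq> \<infinity>" using f by (auto simp: Phi_iff_hypograph)
    obtain M1 where M1: "\<And>x. f x \<le> ereal M1" using Phi_bounded_above[OF f] by blast
    define m where "m = real_of_ereal (SUP x. f x)"
    have SM: "(SUP x. f x) > ereal M" using x by (meson SUP_upper UNIV_I less_le_trans)
    have "(SUP x. f x) \<le> ereal M1" by (rule SUP_least) (rule M1)
    then have m: "(SUP x. f x) = ereal m" using SM by (cases "SUP x. f x") (auto simp: m_def)
    then have mM: "m > M" using SM by simp
    have fle: "f y \<le> ereal m" for y using m by (metis SUP_upper UNIV_I)
    have "ereal (m - 1) < (SUP x. f x)" by (simp add: m)
    then obtain x0 where x0: "ereal (m - 1) < f x0" by (auto simp: less_SUP_iff)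
    \<comment> \<open>With this \<open>K\<close>, the loss \<open>(m + K) * \<delta>\<close> is at least \<open>2 * m\<close>.\<close>
    let ?K = "2 / \<delta> * m"
    have mp: "m \<ge> 0" using mM M by simp
    show False
    proof (cases "prob {x. ereal (- ?K) \<le> f x} \<le> 1 - \<delta>")
      case True
      have "- ?K \<le> 0" using mp d by simp
      then have "- ?K \<le> m" using mp by linarith
      then have "L_fun f Q \<le> ereal (m + 1 - (m + ?K) * \<delta>)"
        using d by (intro L_fun_le_if_small_superlevel fm fle mp True) auto
      also have "m + 1 - (m + ?K) * \<delta> = 1 - m - m * \<delta>" using d by (simp add: field_simps)
      also have "\<dots> < - C" using mM M mp d mult_nonneg_nonneg[of m \<delta>] by linarith
      finally show False using L by simp
    next
      case False
      then have low: "\<And>y. y \<in> cball z r \<Longrightarrow> ereal (- ?K) \<le> f y" using dichotomy[OF f, of ?K] by blast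
      let ?c = "(1 - s) *\<^sub>R x0 + s *\<^sub>R z"
      have "ereal (m / 2 - 1) \<le> f w" if w: "w \<in> cball ?c (s * r)" for w
      proof -
        obtain y where y: "y \<in> cball z r" "w = (1 - s) *\<^sub>R x0 + s *\<^sub>R y"
          using cball_combinationE[OF s(1) w] .
        then have "ereal (- ?K) \<le> f y" using low by blast
        then have "ereal ((1 - s) * (m - 1) + s * (- ?K)) \<le> f w"
          using convex_hypographD[OF cv, of "m - 1" x0 "- ?K" y s] x0 s y(2) by auto
        moreover have "m / 2 - 1 \<le> (1 - s) * (m - 1) + s * (- ?K)"
        proof -
          have "s * (m + ?K) = m / 2"
          proof -
            have "1 + 2 / \<delta> \<noteq> 0" using d by (simp add: field_simps)
            then have "1 / (2 * (1 + 2 / \<delta>)) * ((1 + 2 / \<delta>) * m) = m / 2"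
              by (simp del: distrib_left_numeral)
            moreover have "m + ?K = (1 + 2 / \<delta>) * m" by (simp add: algebra_simps)
            ultimately show ?thesis by (simp only: s_def)
          qed
          moreover have "(1 - s) * (m - 1) + s * (- ?K) = m - 1 + s - s * (m + ?K)" by (simp add: algebra_simps)
          ultimately show ?thesis using s by linarith
        qed
        ultimately show ?thesis by (meson ereal_less_eq(3) order_trans)
      qed
      then have "L_fun f Q \<le> ereal (m + 1 - measure lborel (cball ?c (s * r)) * exp (m / 2 - 1))"
        using s r by (intro L_fun_le_if_ge_on_cball fm fle mp) auto
      also have "measure lborel (cball ?c (s * r)) = V"
        using s r by (simp add: V_def content_cball)
      also have "m + 1 - V * exp (m / 2 - 1) < - C" using M0 mM M by simp
      finally show False using L by simp
    qed
  qed
  \<comment> \<open>With this \<open>K\<close>, the loss \<open>K * \<delta>\<close> outweighs the upper bound \<open>M + 1\<close> by more than \<open>C\<close>.\<close>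
  define K where "K = (M + \<bar>C\<bar> + 2) / \<delta>"
  have K: "K \<ge> 0" "K * \<delta> = M + \<bar>C\<bar> + 2" using d M by (auto simp: K_def)
  have lower: "ereal (- K) \<le> f x" if f: "f \<in> Phi" and L: "L_fun f Q \<ge> ereal (- C)" and x: "x \<in> cball z r" for f x
  proof (rule ccontr)
    assume "\<not> ereal (- K) \<le> f x"
    then have "prob {x. ereal (- K) \<le> f x} \<le> 1 - \<delta>" using dichotomy[OF f, of K] x by blast
    then have "L_fun f Q \<le> ereal (M + 1 - (M + K) * \<delta>)"
      using d K M by (intro L_fun_le_if_small_superlevel borel_measurable_Phi f upper L) auto
    also have "M + 1 - (M + K) * \<delta> < - C"
    proof -
      have "M * \<delta> \<ge> 0" using M(1) d(1) by simp
      then show ?thesis using K(2) by (simp add: distrib_right)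
    qed
    finally show False using L by simp
  qed
  show ?thesis using that[of r M K] r M(1) upper lower by blast
qed

end

section \<open>Strict concavity and uniqueness of the maximizer\<close>

definition midpoint_fun :: "('a \<Rightarrow> ereal) \<Rightarrow> ('a \<Rightarrow> ereal) \<Rightarrow> 'a \<Rightarrow> ereal" where
  "midpoint_fun f g = (\<lambda>x. ereal (1/2) * (f x + g x))"

lemma midpoint_fun_ge:
  "\<lbrakk>ereal a \<le> f x; ereal b \<le> g x\<rbrakk> \<Longrightarrow> ereal ((a + b) / 2) \<le> midpoint_fun f g x"
  by (cases "f x"; cases "g x") (auto simp: midpoint_fun_def)

lemma midpoint_fun_less:
  "\<lbrakk>f x < ereal a; g x < ereal b\<rbrakk> \<Longrightarrow> midpoint_fun f g x < ereal ((a + b) / 2)"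
  by (cases "f x"; cases "g x") (auto simp: midpoint_fun_def)

text \<open>
  Concavity and semicontinuity pass to the sum. Wherever the midpoint is at least \<open>a\<close>, one of the two
  functions is, so the superlevel sets stay bounded.
\<close>

lemma midpoint_fun_Phi:
  assumes f: "f \<in> Phi" and g: "g \<in> Phi"
  shows "midpoint_fun f g \<in> Phi"
proof -
  let ?m = "midpoint_fun f g"
  have F: "\<And>x. f x \<noteq> \<infinity>" "convex (hypograph f)" "upper_semicont f" "\<And>a. bounded {x. ereal a \<le> f x}"
    using f by (auto simp: Phi_iff_hypograph upper_semicont_iff_closed_hypograph)
  have G: "\<And>x. g x \<noteq> \<infinity>" "convex (hypograph g)" "upper_semicont g" "\<And>a. bounded {x. ereal a \<le> g x}"
    using g by (auto simp: Phi_iff_hypograph upper_semicont_iff_closed_hypograph)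
  have fin: "?m x \<noteq> \<infinity>" for x
    using F(1)[of x] G(1)[of x] by (cases "f x"; cases "g x") (auto simp: midpoint_fun_def)
  have split: "\<exists>p q. f x = ereal p \<and> g x = ereal q \<and> a \<le> (p + q) / 2" if "ereal a \<le> ?m x" for a x
    using that F(1)[of x] G(1)[of x] by (cases "f x"; cases "g x") (auto simp: midpoint_fun_def)
  have "convex (hypograph ?m)"
    unfolding convex_alt
  proof (intro ballI allI impI, clarsimp)
    fix x a y b and t :: real
    assume *: "ereal a \<le> ?m x" "ereal b \<le> ?m y" "0 \<le> t" "t \<le> 1"
    obtain p q where pq: "f x = ereal p" "g x = ereal q" "a \<le> (p + q) / 2" using split[OF *(1)] by blast
    obtain p' q' where pq': "f y = ereal p'" "g y = ereal q'" "b \<le> (p' + q') / 2" using split[OF *(2)] by blast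
    have "ereal ((((1 - t) * p + t * p') + ((1 - t) * q + t * q')) / 2) \<le> ?m ((1 - t) *\<^sub>R x + t *\<^sub>R y)"
      using pq pq' * by (intro midpoint_fun_ge convex_hypographD F G) auto
    moreover have "(1 - t) * a + t * b \<le> (1 - t) * ((p + q) / 2) + t * ((p' + q') / 2)"
      using * pq pq' by (intro add_mono mult_left_mono) auto
    moreover have "\<dots> = (((1 - t) * p + t * p') + ((1 - t) * q + t * q')) / 2" by (simp add: field_simps)
    ultimately show "ereal ((1 - t) * a + t * b) \<le> ?m ((1 - t) *\<^sub>R x + t *\<^sub>R y)"
      by (metis ereal_less_eq(3) order_trans)
  qed
  moreover have "upper_semicont ?m"
    unfolding upper_semicont_iff_eventually
  proof (intro allI impI)
    fix x b assume less: "?m x < ereal b"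
    \<comment> \<open>Distribute the gap between \<open>?m x\<close> and \<open>b\<close> onto the two summands; a summand with value \<open>-\<infinity>\<close>
      accepts any real bound.\<close>
    have "\<exists>p q. f x < ereal p \<and> g x < ereal q \<and> (p + q) / 2 = b"
    proof (cases "f x")
      case (real u)
      show ?thesis
      proof (cases "g x")
        case (real v)
        then have "(u + v) / 2 < b" using less \<open>f x = ereal u\<close> by (simp add: midpoint_fun_def)
        then show ?thesis using real \<open>f x = ereal u\<close>
          by (intro exI[of _ "u + (b - (u + v) / 2)"] exI[of _ "v + (b - (u + v) / 2)"]) (auto simp: field_simps)
      next
        case MInf
        then show ?thesis using real by (intro exI[of _ "u + 1"] exI[of _ "2 * b - (u + 1)"]) auto
      qed (use G in auto)
    next
      case MInf
      obtain q where "g x < ereal q"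
        using G(1)[of x] by (metis ereal_infty_less(1) less_PInf_Ex_of_nat)
      then show ?thesis using MInf by (intro exI[of _ "2 * b - q"] exI[of _ q]) auto
    qed (use F in auto)
    then obtain p q where pq: "f x < ereal p" "g x < ereal q" "(p + q) / 2 = b" by blast
    have "\<forall>\<^sub>F y in nhds x. f y < ereal p" "\<forall>\<^sub>F y in nhds x. g y < ereal q"
      using upper_semicont_iff_eventually[THEN iffD1, OF F(3)]
        upper_semicont_iff_eventually[THEN iffD1, OF G(3)] pq by auto
    then show "\<forall>\<^sub>F y in nhds x. ?m y < ereal b"
      by eventually_elim (rule midpoint_fun_less[of f _ p g q, unfolded pq(3)])
  qed
  moreover have "bounded {x. ereal a \<le> ?m x}" for a
  proof (rule bounded_subset)
    show "bounded ({x. ereal a \<le> f x} \<union> {x. ereal a \<le> g x})" using F G by simp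
    show "{x. ereal a \<le> ?m x} \<subseteq> {x. ereal a \<le> f x} \<union> {x. ereal a \<le> g x}"
    proof
      fix x assume "x \<in> {x. ereal a \<le> ?m x}"
      then obtain p q where "f x = ereal p" "g x = ereal q" "a \<le> (p + q) / 2" using split by blast
      moreover then have "a \<le> p \<or> a \<le> q" by (cases "a \<le> p") auto
      ultimately show "x \<in> {x. ereal a \<le> f x} \<union> {x. ereal a \<le> g x}" by auto
    qed
  qed
  ultimately show ?thesis using fin by (simp add: Phi_iff_hypograph upper_semicont_iff_closed_hypograph)
qed

text \<open>
  The square root of \<open>exp_ereal\<close>, as a real number so that differences can be formed. Functions in
  \<open>Phi\<close> omit the value \<open>\<infinity>\<close>; there the default 0 is used.
\<close>

definition exp_half :: "ereal \<Rightarrow> real" where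
  "exp_half y = (if \<bar>y\<bar> = \<infinity> then 0 else exp (real_of_ereal y / 2))"

lemma exp_half_simps [simp]: "exp_half (ereal r) = exp (r / 2)" "exp_half (-\<infinity>) = 0"
  by (simp_all add: exp_half_def)

lemma exp_half_nonneg [simp]: "exp_half y \<ge> 0" by (simp add: exp_half_def)

lemma exp_half_inj: "x \<noteq> \<infinity> \<Longrightarrow> y \<noteq> \<infinity> \<Longrightarrow> exp_half x = exp_half y \<Longrightarrow> x = y"
  by (cases x; cases y) auto

lemma exp_ereal_eq_exp_half: "x \<noteq> \<infinity> \<Longrightarrow> exp_ereal x = ennreal ((exp_half x)\<^sup>2)"
  by (cases x) (auto simp: power2_eq_square exp_add[symmetric])

lemma borel_measurable_exp_half [measurable]: "exp_half \<in> borel_measurable borel"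
  unfolding exp_half_def by measurable

lemma exp_square: "(exp (a / 2))\<^sup>2 = exp (a::real)"
  by (simp add: power2_eq_square exp_add[symmetric])

text \<open>
  For real arguments this is \<open>p\<^sup>2 + q\<^sup>2 = 2 * p * q + (p - q)\<^sup>2\<close> with \<open>p = exp (a/2)\<close> and \<open>q = exp (b/2)\<close>.
\<close>

lemma exp_ereal_parallelogram:
  assumes "f x \<noteq> \<infinity>" "g x \<noteq> \<infinity>"
  shows "exp_ereal (f x) + exp_ereal (g x)
    = exp_ereal (midpoint_fun f g x) + exp_ereal (midpoint_fun f g x) + ennreal ((exp_half (f x) - exp_half (g x))\<^sup>2)"
proof -
  have *: "exp a + exp b = exp ((a + b) / 2) + exp ((a + b) / 2) + (exp (a/2) - exp (b/2))\<^sup>2" for a b :: real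
    by (simp add: power2_eq_square algebra_simps exp_add[symmetric] add_divide_distrib)
  have **: "ennreal (exp a) + ennreal (exp b) = ennreal (exp ((a + b) / 2)) + ennreal (exp ((a + b) / 2)) + ennreal ((exp (a/2) - exp (b/2))\<^sup>2)" for a b :: real
    by (simp only: ennreal_plus[symmetric] exp_ge_zero zero_le_power2 add_nonneg_nonneg *[symmetric])
  show ?thesis
  proof (cases "f x")
    case (real a)
    show ?thesis
    proof (cases "g x")
      case (real b)
      then show ?thesis using \<open>f x = ereal a\<close> **[of a b] by (simp add: midpoint_fun_def)
    next
      case MInf
      then show ?thesis using \<open>f x = ereal a\<close> by (simp add: midpoint_fun_def exp_square)
    qed (use assms in simp)
  next
    case MInf
    then show ?thesis using assms by (cases "g x") (simp_all add: midpoint_fun_def exp_square)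
  qed (use assms in simp)
qed

lemma ex_in_cball_of_AE:
  fixes c :: "'a::euclidean_space"
  assumes "AE w in lborel. P w" "r > 0"
  shows "\<exists>w\<in>cball c r. P w"
proof (rule ccontr)
  assume no: "\<not> ?thesis"
  have "AE w in lborel. w \<notin> cball c r" using assms(1) by (rule AE_mp) (use no in auto)
  then have "cball c r \<in> null_sets lborel" by (subst AE_iff_null_sets) auto
  then have "measure lborel (cball c r) = 0" by (simp add: measure_def null_setsD1)
  then show False using content_cball_pos[OF assms(2), of c] by simp
qed

text \<open>
  Passes from almost every point to a given point \<open>x\<close>: the shrunken balls
  \<open>(1 - s) *\<^sub>R x + s *\<^sub>R cball z r\<close> have positive measure, so each contains a point at which the bound is
  available. These points and bounds tend to \<open>x\<close> and \<open>a\<close> as \<open>s\<close> tends to 0, and the hypograph is closed.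
\<close>

lemma hypograph_mem_of_AE_near_segment:
  fixes g :: "'a::euclidean_space \<Rightarrow> ereal"
  assumes g: "closed (hypograph g)" and r: "r > 0" and P: "AE w in lborel. P w"
    and ge: "\<And>s y. \<lbrakk>0 < s; s < 1; y \<in> cball z r; P ((1 - s) *\<^sub>R x + s *\<^sub>R y)\<rbrakk>
      \<Longrightarrow> ereal ((1 - s) * a + s * b) \<le> g ((1 - s) *\<^sub>R x + s *\<^sub>R y)"
  shows "ereal a \<le> g x"
proof -
  define s where "s n = 1 / (real n + 2)" for n
  have s: "0 < s n" "s n < 1" for n by (auto simp: s_def)
  have s0: "s \<longlonglongrightarrow> 0" unfolding s_def by real_asymp
  have "\<exists>y\<in>cball z r. P ((1 - s n) *\<^sub>R x + s n *\<^sub>R y)" for n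
  proof -
    obtain w where w: "w \<in> cball ((1 - s n) *\<^sub>R x + s n *\<^sub>R z) (s n * r)" "P w"
      using ex_in_cball_of_AE[OF P mult_pos_pos[OF s(1) r]] by blast
    show ?thesis using cball_combinationE[OF s(1) w(1)] w(2) by metis
  qed
  then obtain y where y: "\<And>n. y n \<in> cball z r" "\<And>n. P ((1 - s n) *\<^sub>R x + s n *\<^sub>R y n)" by metis
  let ?p = "\<lambda>n. ((1 - s n) *\<^sub>R x + s n *\<^sub>R y n, (1 - s n) * a + s n * b)"
  have mem: "?p n \<in> hypograph g" for n using ge[OF s(1) s(2) y(1) y(2)] by simp
  have bdd: "norm (y n) \<le> norm z + r" for n
    using y(1)[of n] norm_triangle_ineq[of "y n - z" z] by (simp add: dist_norm norm_minus_commute)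
  have "(\<lambda>n. s n *\<^sub>R y n) \<longlonglongrightarrow> 0"
  proof (rule Lim_null_comparison)
    show "\<forall>\<^sub>F n in sequentially. norm (s n *\<^sub>R y n) \<le> s n * (norm z + r)"
      using s bdd by (intro always_eventually) (auto simp: abs_of_pos intro!: mult_left_mono less_imp_le)
    show "(\<lambda>n. s n * (norm z + r)) \<longlonglongrightarrow> 0" using tendsto_mult_right[OF s0] by simp
  qed
  then have "?p \<longlonglongrightarrow> ((1 - 0) *\<^sub>R x + 0, (1 - 0) * a + 0 * b)"
    by (intro tendsto_intros s0)
  then have lim: "?p \<longlonglongrightarrow> (x, a)" by simp
  have "(x, a) \<in> hypograph g"
    by (rule closed_sequentially[OF g _ lim]) (rule mem)
  then show ?thesis by simp
qed

text \<open>
  The ball on which \<open>f\<close> is bounded below supplies, by concavity, lower bounds for \<open>f\<close> on the shrunken balls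
  that approach \<open>x\<close>.
\<close>

lemma Phi_le_of_AE_le:
  assumes f: "f \<in> Phi" and g: "g \<in> Phi" and ae: "AE x in lborel. f x \<le> g x"
    and r: "r > 0" and low: "\<And>y. y \<in> cball z r \<Longrightarrow> ereal b \<le> f y"
  shows "f x \<le> g x"
proof (rule ereal_le_if_real_le)
  fix a assume a: "ereal a \<le> f x"
  show "ereal a \<le> g x"
  proof (rule hypograph_mem_of_AE_near_segment[OF _ r ae, where b = b])
    show "closed (hypograph g)" using g by (simp add: Phi_iff_hypograph)
    fix s y assume s: "0 < s" "s < 1" and y: "y \<in> cball z r"
      and le: "f ((1 - s) *\<^sub>R x + s *\<^sub>R y) \<le> g ((1 - s) *\<^sub>R x + s *\<^sub>R y)"
    have "ereal ((1 - s) * a + s * b) \<le> f ((1 - s) *\<^sub>R x + s *\<^sub>R y)"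
      using f a low[OF y] s by (intro convex_hypographD) (auto simp: Phi_iff_hypograph)
    then show "ereal ((1 - s) * a + s * b) \<le> g ((1 - s) *\<^sub>R x + s *\<^sub>R y)"
      using le by (rule order_trans)
  qed
qed

context borel_prob_space
begin

text \<open>
  The quantitative form of the strict concavity of \<open>L_fun\<close>.
\<close>

lemma cost_midpoint:
  assumes f: "f \<in> Phi" "\<And>x. f x \<le> ereal M" and g: "g \<in> Phi" "\<And>x. g x \<le> ereal M"
  shows "cost M f + cost M g = cost M (midpoint_fun f g) + cost M (midpoint_fun f g)
    + (\<integral>\<^sup>+x. ennreal ((exp_half (f x) - exp_half (g x))\<^sup>2) \<partial>lborel)"
proof -
  let ?m = "midpoint_fun f g"
  have [measurable]: "f \<in> borel_measurable borel" "g \<in> borel_measurable borel" "?m \<in> borel_measurable borel"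
    using f(1) g(1) midpoint_fun_Phi[OF f(1) g(1)] by (simp_all add: borel_measurable_Phi)
  have [measurable]: "f \<in> borel_measurable Q" "g \<in> borel_measurable Q" "?m \<in> borel_measurable Q" by simp_all
  have fin: "f x \<noteq> \<infinity>" "g x \<noteq> \<infinity>" for x using f g by (auto simp: Phi_iff_hypograph)
  have lin: "e2ennreal (ereal M - f x) + e2ennreal (ereal M - g x) = e2ennreal (ereal M - ?m x) + e2ennreal (ereal M - ?m x)" for x
  proof (cases "f x")
    case (real a)
    show ?thesis
    proof (cases "g x")
      case (real b)
      have "a \<le> M" "b \<le> M" using f(2)[of x] g(2)[of x] \<open>f x = ereal a\<close> real by auto
      then show ?thesis using real \<open>f x = ereal a\<close>
        by (simp add: midpoint_fun_def ennreal_plus[symmetric] field_simps del: ennreal_plus)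
    qed (use fin real in \<open>auto simp: midpoint_fun_def\<close>)
  next
    case MInf
    then show ?thesis using fin[of x] by (cases "g x") (auto simp: midpoint_fun_def)
  qed (use fin in auto)
  have 1: "(\<integral>\<^sup>+x. e2ennreal (ereal M - f x) \<partial>Q) + (\<integral>\<^sup>+x. e2ennreal (ereal M - g x) \<partial>Q)
      = (\<integral>\<^sup>+x. e2ennreal (ereal M - ?m x) \<partial>Q) + (\<integral>\<^sup>+x. e2ennreal (ereal M - ?m x) \<partial>Q)"
    by (simp add: nn_integral_add[symmetric] lin)
  have 2: "(\<integral>\<^sup>+x. exp_ereal (f x) \<partial>lborel) + (\<integral>\<^sup>+x. exp_ereal (g x) \<partial>lborel)
      = (\<integral>\<^sup>+x. exp_ereal (?m x) \<partial>lborel) + (\<integral>\<^sup>+x. exp_ereal (?m x) \<partial>lborel)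
        + (\<integral>\<^sup>+x. ennreal ((exp_half (f x) - exp_half (g x))\<^sup>2) \<partial>lborel)"
    by (simp add: nn_integral_add[symmetric] exp_ereal_parallelogram fin)
  have comb: "a + e + (b + e') = c + h + (c + h) + d" if "a + b = c + c" "e + e' = h + h + d"
    for a b c d e e' h :: ennreal
  proof -
    have "a + e + (b + e') = (a + b) + (e + e')" by (simp add: ac_simps)
    then show ?thesis unfolding that by (simp add: ac_simps)
  qed
  show ?thesis unfolding cost_def by (rule comb[OF 1 2])
qed

lemma cost_le_of_L_fun_ge:
  assumes "f \<in> borel_measurable borel" "\<And>x. f x \<le> ereal M" "M \<ge> 0" "ereal l \<le> L_fun f Q"
  shows "cost M f \<le> ennreal (M + 1 - l)"
  using assms(4) unfolding L_fun_eq_cost[OF assms(1-3)]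
  by (cases "cost M f") (auto intro!: ennreal_leI)

lemma cost_ge_of_L_fun_le:
  assumes "f \<in> borel_measurable borel" "\<And>x. f x \<le> ereal M" "M \<ge> 0" "L_fun f Q \<le> ereal l"
  shows "ennreal (M + 1 - l) \<le> cost M f"
  using assms(4) unfolding L_fun_eq_cost[OF assms(1-3)]
  by (cases "cost M f") (auto intro!: ennreal_leI)

text \<open>
  The cost of the midpoint is at least \<open>M + 1 - S\<close>, and those of \<open>f\<close> and \<open>g\<close> exceed this by at
  most \<open>\<eta>\<close>; the identity for the midpoint leaves at most \<open>2 * \<eta>\<close> for the integral.
\<close>

lemma near_maximizers_L2_close:
  assumes S: "\<And>h. h \<in> Phi \<Longrightarrow> L_fun h Q \<le> ereal S"
    and f: "f \<in> Phi" "ereal (S - \<eta>) \<le> L_fun f Q" and g: "g \<in> Phi" "ereal (S - \<eta>) \<le> L_fun g Q"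
  shows "(\<integral>\<^sup>+x. ennreal ((exp_half (f x) - exp_half (g x))\<^sup>2) \<partial>lborel) \<le> ennreal (2 * \<eta>)"
proof -
  obtain M1 where M1: "M1 \<ge> 0" "\<And>x. f x \<le> ereal M1" using Phi_bounded_above[OF f(1)] by blast
  obtain M2 where M2: "M2 \<ge> 0" "\<And>x. g x \<le> ereal M2" using Phi_bounded_above[OF g(1)] by blast
  define M where "M = max M1 M2"
  have M: "M \<ge> 0" "M1 \<le> M" "M2 \<le> M" using M1 by (auto simp: M_def)
  have fM: "f x \<le> ereal M" "g x \<le> ereal M" for x
    using M M1(2)[of x] M2(2)[of x] by (meson ereal_less_eq(3) order_trans)+
  let ?m = "midpoint_fun f g"
  have mPhi: "?m \<in> Phi" using midpoint_fun_Phi f g by blast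
  have mM: "?m x \<le> ereal M" for x
    using fM(1,2)[of x] by (cases "f x"; cases "g x") (auto simp: midpoint_fun_def)
  let ?D = "\<integral>\<^sup>+x. ennreal ((exp_half (f x) - exp_half (g x))\<^sup>2) \<partial>lborel"
  let ?c = "M + 1 - S"
  have eq: "cost M f + cost M g = cost M ?m + cost M ?m + ?D"
    using f g fM by (intro cost_midpoint) auto
  have cf: "cost M f \<le> ennreal (M + 1 - (S - \<eta>))" "cost M g \<le> ennreal (M + 1 - (S - \<eta>))"
    using f g fM M by (auto intro!: cost_le_of_L_fun_ge borel_measurable_Phi)
  have cm: "ennreal ?c \<le> cost M ?m"
    using mPhi mM M S by (intro cost_ge_of_L_fun_le borel_measurable_Phi) auto
  have cfc: "ennreal ?c \<le> cost M f"
    using f fM M S by (intro cost_ge_of_L_fun_le borel_measurable_Phi) auto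
  obtain a where a: "cost M f = ennreal a" "a \<ge> 0" using cf(1) by (cases "cost M f") (auto simp: top_unique)
  obtain b where b: "cost M g = ennreal b" "b \<ge> 0" using cf(2) by (cases "cost M g") (auto simp: top_unique)
  have "cost M ?m + cost M ?m + ?D \<noteq> top" using eq[symmetric] a b by simp
  then have "cost M ?m \<noteq> top" "?D \<noteq> top" by auto
  then obtain c where c: "cost M ?m = ennreal c" "c \<ge> 0" by (cases "cost M ?m") auto
  obtain d where d: "?D = ennreal d" "d \<ge> 0" using \<open>?D \<noteq> top\<close> by (cases ?D) auto
  have "a + b = c + c + d" using eq a b c d by (simp flip: ennreal_plus)
  moreover have "?c \<le> c" using cm c by (simp add: ennreal_le_iff)
  moreover have "a \<le> max 0 (M + 1 - (S - \<eta>))" "b \<le> max 0 (M + 1 - (S - \<eta>))"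
    using cf a b by (auto simp: ennreal_le_iff2 max_def)
  ultimately have "d \<le> 2 * \<eta> \<or> d = 0" using c(2) a(2) b(2) d(2) by (auto simp: max_def split: if_splits)
  then show ?thesis using d by (auto intro: ennreal_leI)
qed

text \<open>
  Both functions are near-maximizers with error 0, so they agree almost everywhere. The ball on which they
  are bounded below allows the comparison at every point.
\<close>

lemma maximizer_unique:
  assumes z: "z \<in> interior (csupp Q)" and S: "\<And>h. h \<in> Phi \<Longrightarrow> L_fun h Q \<le> ereal S"
    and f: "f \<in> Phi" "ereal S \<le> L_fun f Q" and g: "g \<in> Phi" "ereal S \<le> L_fun g Q"
  shows "f = g"
proof -
  have [measurable]: "f \<in> borel_measurable borel" "g \<in> borel_measurable borel"
    using f g by (auto intro: borel_measurable_Phi)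
  have "(\<integral>\<^sup>+x. ennreal ((exp_half (f x) - exp_half (g x))\<^sup>2) \<partial>lborel) \<le> ennreal (2 * 0)"
    using near_maximizers_L2_close[of S f 0 g] S f g by simp
  then have "AE x in lborel. ennreal ((exp_half (f x) - exp_half (g x))\<^sup>2) = 0"
    by (subst nn_integral_0_iff_AE[symmetric]) auto
  then have ae: "AE x in lborel. f x = g x"
    by (rule AE_mp) (use f g in \<open>auto simp: Phi_iff_hypograph intro!: AE_I2 exp_half_inj\<close>)
  obtain r M K where r: "r > 0" and
    K: "\<And>f x. \<lbrakk>f \<in> Phi; L_fun f Q \<ge> ereal (- (- S)); x \<in> cball z r\<rbrakk> \<Longrightarrow> ereal (- K) \<le> f x"
    using Phi_uniform_bounds[OF z, of "- S"] by metis
  show ?thesis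
  proof
    fix x
    have "f x \<le> g x"
      by (rule Phi_le_of_AE_le[OF f(1) g(1) _ r K[OF f(1)]]) (use ae f in auto)
    moreover have "g x \<le> f x"
      by (rule Phi_le_of_AE_le[OF g(1) f(1) _ r K[OF g(1)]]) (use ae g in auto)
    ultimately show "f x = g x" by simp
  qed
qed

end

section \<open>The upper semicontinuous hull of a concave function\<close>

text \<open>
  The function whose hypograph is the closure of the given one; closedness and convexity are then
  properties of closures of sets.
\<close>

definition usc_hull :: "('a::topological_space \<Rightarrow> ereal) \<Rightarrow> 'a \<Rightarrow> ereal" where
  "usc_hull f x = (SUP a\<in>{a. (x, a) \<in> closure (hypograph f)}. ereal a)"

lemma closure_hypograph_down:
  fixes f :: "'a::metric_space \<Rightarrow> ereal"
  assumes "(x, a) \<in> closure (hypograph f)" "b \<le> a"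
  shows "(x, b) \<in> closure (hypograph f)"
proof -
  obtain p where p: "\<And>n. p n \<in> hypograph f" "p \<longlonglongrightarrow> (x, a)"
    using assms(1) unfolding closure_sequential by blast
  let ?q = "\<lambda>n. (fst (p n), snd (p n) - (a - b))"
  have "?q n \<in> hypograph f" for n
  proof -
    have "ereal (snd (p n) - (a - b)) \<le> ereal (snd (p n))" using assms(2) by simp
    also have "\<dots> \<le> f (fst (p n))" using p(1)[of n] by (simp add: hypograph_def)
    finally show ?thesis by simp
  qed
  moreover have "?q \<longlonglongrightarrow> (fst (x, a), snd (x, a) - (a - b))"
    by (intro tendsto_intros p(2))
  then have "?q \<longlonglongrightarrow> (x, b)" by simp
  ultimately show ?thesis unfolding closure_sequential by (intro exI[of _ ?q] conjI allI)
qed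

lemma usc_hull_le:
  fixes f :: "'a::metric_space \<Rightarrow> ereal"
  assumes "\<And>x. f x \<le> ereal M"
  shows "usc_hull f x \<le> ereal M"
proof -
  have "closure (hypograph f) \<subseteq> UNIV \<times> {..M}"
  proof (rule closure_minimal)
    show "hypograph f \<subseteq> UNIV \<times> {..M}"
    proof clarsimp
      fix x a assume "ereal a \<le> f x"
      then have "ereal a \<le> ereal M" using assms by (rule order_trans)
      then show "a \<le> M" by simp
    qed
    show "closed (UNIV \<times> {..M} :: ('a \<times> real) set)" by (intro closed_Times) auto
  qed
  then show ?thesis unfolding usc_hull_def by (intro SUP_least) auto
qed

lemma usc_hull_ge: "f x \<le> usc_hull f x"
proof (rule ereal_le_if_real_le)
  fix a assume "ereal a \<le> f x"
  then have "(x, a) \<in> closure (hypograph f)" using closure_subset by fastforce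
  then show "ereal a \<le> usc_hull f x" unfolding usc_hull_def by (intro SUP_upper) simp
qed

text \<open>
  The fibres of the closure over each point are downward closed and closed, so their supremum
  is attained if it is finite.
\<close>

lemma hypograph_usc_hull:
  fixes f :: "'a::metric_space \<Rightarrow> ereal"
  shows "hypograph (usc_hull f) = closure (hypograph f)"
proof (intro set_eqI iffI)
  fix p assume "p \<in> closure (hypograph f)"
  then show "p \<in> hypograph (usc_hull f)"
    by (cases p) (auto simp: usc_hull_def intro!: SUP_upper)
next
  fix p assume p: "p \<in> hypograph (usc_hull f)"
  obtain x a where pxa: "p = (x, a)" by force
  have "\<And>n. (x, a - 1 / real (Suc n)) \<in> closure (hypograph f)"
  proof -
    fix n
    \<comment> \<open>Slightly below the supremum there are genuine points of the closure; their limit is \<open>(x, a)\<close>.\<close>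
    have "ereal (a - 1 / real (Suc n)) < ereal a" by simp
    also have "\<dots> \<le> usc_hull f x" using p pxa by simp
    finally obtain a' where a': "(x, a') \<in> closure (hypograph f)" "ereal (a - 1 / real (Suc n)) < ereal a'"
      by (auto simp: usc_hull_def less_SUP_iff simp del: of_nat_Suc)
    have "a - 1 / real (Suc n) \<le> a'" using a'(2) unfolding less_ereal.simps by (rule less_imp_le)
    then show "(x, a - 1 / real (Suc n)) \<in> closure (hypograph f)" by (rule closure_hypograph_down[OF a'(1)])
  qed
  moreover have "(\<lambda>n. (x, a - 1 / real (Suc n))) \<longlonglongrightarrow> (x, a - 0)"
    by (intro tendsto_intros LIMSEQ_Suc[OF lim_1_over_n])
  then have "(\<lambda>n. (x, a - 1 / real (Suc n))) \<longlonglongrightarrow> (x, a)" by simp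
  ultimately have "(x, a) \<in> closure (hypograph f)"
    by (rule closed_sequentially[OF closed_closure])
  then show "p \<in> closure (hypograph f)" using pxa by simp
qed

text \<open>
  The points between \<open>f\<close> and its hull lie in the frontier of the convex set \<open>hypograph f\<close>, a null set in
  the product space. By Fubini, almost every fibre of the frontier is a null set, whereas a gap
  \<open>f x < usc_hull f x\<close> would put a whole interval into the fibre over \<open>x\<close>.
\<close>

lemma AE_usc_hull_eq:
  fixes f :: "'a::euclidean_space \<Rightarrow> ereal"
  assumes cv: "convex (hypograph f)"
  shows "AE x in lborel. usc_hull f x = f x"
proof -
  let ?H = "hypograph f"
  have "negligible (frontier ?H)" by (rule negligible_convex_frontier[OF cv])
  then have "frontier ?H \<in> null_sets lborel"
    by (simp add: negligible_iff_null_sets null_sets_completion_iff)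
  then have "AE p in lborel. p \<notin> frontier ?H" by (rule AE_not_in)
  then have "AE p in (lborel :: 'a measure) \<Otimes>\<^sub>M (lborel :: real measure). p \<notin> frontier ?H"
    by (subst lborel_prod)
  then have "AE x in (lborel :: 'a measure). AE a in (lborel :: real measure). (x, a) \<notin> frontier ?H"
    by (rule lborel_pair.AE_pair)
  then show ?thesis
  proof (rule AE_mp, intro AE_I2 impI)
    fix x assume ae: "AE a in (lborel :: real measure). (x, a) \<notin> frontier ?H"
    show "usc_hull f x = f x"
    proof (rule ccontr)
      assume "usc_hull f x \<noteq> f x"
      then have "f x < usc_hull f x" using usc_hull_ge[of f x] by simp
      then obtain p where p: "f x < ereal p" "ereal p < usc_hull f x"
        using ereal_dense2[of "f x" "usc_hull f x"] by blast
      then obtain q where q: "ereal p < ereal q" "ereal q < usc_hull f x"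
        using ereal_dense2[of "ereal p" "usc_hull f x"] by blast
      then have "(q - p) / 2 > 0" by simp
      then obtain a where a: "a \<in> cball ((p + q) / 2) ((q - p) / 2)" "(x, a) \<notin> frontier ?H"
        using ex_in_cball_of_AE[OF ae] by blast
      have pq: "p \<le> a" "a \<le> q" using a(1) by (auto simp: dist_real_def abs_if field_simps split: if_splits)
      have "ereal a \<le> usc_hull f x" using pq(2) q(2) by (meson ereal_less_eq(3) less_imp_le order_trans)
      then have "(x, a) \<in> hypograph (usc_hull f)" by simp
      then have "(x, a) \<in> closure ?H" by (simp only: hypograph_usc_hull)
      moreover have "ereal p \<le> ereal a" using pq(1) by simp
      then have "f x < ereal a" using p(1) by (rule less_le_trans[rotated])
      then have "(x, a) \<notin> ?H" by simp
      ultimately have "(x, a) \<in> frontier ?H" using interior_subset unfolding frontier_def by blast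
      then show False using a(2) by simp
    qed
  qed
qed

text \<open>
  If the set contained a point \<open>x\<close> far from \<open>z\<close>, then by convexity it would contain the cone over
  \<open>cball z r\<close> with apex \<open>x\<close>. In the half of the cone next to \<open>z\<close>, balls of radius \<open>r / 2\<close> fit, and the
  number of disjoint ones grows with the distance.
\<close>

lemma bounded_convex_of_finite_measure:
  fixes C :: "'a::euclidean_space set"
  assumes cv: "convex C" and Cm: "C \<in> sets lborel" and r: "r > 0" "cball z r \<subseteq> C"
    and fin: "emeasure lborel C < \<infinity>"
  shows "bounded C"
proof (rule ccontr)
  assume nb: "\<not> bounded C"
  let ?V = "measure lborel (ball (0::'a) (r / 2))"
  have V: "?V > 0" using r(1) by (intro content_ball_pos) simp
  have Vball: "emeasure lborel (ball c (r / 2)) = ennreal ?V" for c :: 'a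
  proof -
    have "emeasure lborel (ball c (r / 2)) = ennreal (measure lborel (ball c (r / 2)))"
      by (intro emeasure_eq_ennreal_measure) (use emeasure_lborel_ball_finite[of c "r / 2"] in \<open>auto simp: less_top\<close>)
    then show ?thesis using r(1) by (simp add: content_ball)
  qed
  have big: "ennreal (real N * ?V) \<le> emeasure lborel C" for N :: nat
  proof -
    obtain x where x: "x \<in> C" "norm (x - z) > 2 * real N * r + r"
    proof -
      have "\<not> C \<subseteq> cball z (2 * real N * r + r)" using nb bounded_cball bounded_subset by blast
      then obtain x where "x \<in> C" "x \<notin> cball z (2 * real N * r + r)" by blast
      then show ?thesis using that[of x] by (simp add: dist_norm norm_minus_commute)
    qed
    define d where "d = norm (x - z)"
    have "2 * real N * r \<ge> 0" using r(1) by simp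
    then have d: "d > 2 * real N * r" "d > 0" using x(2) r(1) unfolding d_def by linarith+
    \<comment> \<open>Centres at distance \<open>r\<close> from each other on the segment from \<open>z\<close> to \<open>x\<close>; those with \<open>k < N\<close> stay in the
      half next to \<open>z\<close>, where the homothetic images of \<open>cball z r\<close> have radius at least \<open>r / 2\<close>.\<close>
    define c where "c k = z + (real k * r / d) *\<^sub>R (x - z)" for k :: nat
    have dist_c: "dist (c j) (c k) = \<bar>real j - real k\<bar> * r" for j k
    proof -
      have "c j - c k = ((real j - real k) * r / d) *\<^sub>R (x - z)" by (simp add: c_def algebra_simps diff_divide_distrib)
      then have "dist (c j) (c k) = \<bar>(real j - real k) * r / d\<bar> * d" by (simp add: dist_norm d_def)
      then show ?thesis using d(2) r(1) by (simp add: abs_mult)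
    qed
    have disj: "disjoint_family_on (\<lambda>k. ball (c k) (r / 2)) {..<N}"
    proof (unfold disjoint_family_on_def, intro ballI impI)
      fix j k :: nat assume "j \<noteq> k"
      then have "\<bar>real j - real k\<bar> \<ge> 1" by linarith
      then have "r \<le> dist (c j) (c k)" using r(1) by (simp add: dist_c)
      then show "ball (c j) (r / 2) \<inter> ball (c k) (r / 2) = {}" by (intro disjoint_ballI) simp
    qed
    have sub: "ball (c k) (r / 2) \<subseteq> C" if k: "k < N" for k
    proof
      fix w assume w: "w \<in> ball (c k) (r / 2)"
      define s where "s = 1 - real k * r / d"
      have "real k * r \<le> real N * r" using k r(1) by simp
      then have "real k * r / d \<le> 1 / 2" using d by (simp add: field_simps)
      then have s: "s \<ge> 1 / 2" "s \<le> 1" using d(2) r(1) by (auto simp: s_def)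
      have "c k = (1 - s) *\<^sub>R x + s *\<^sub>R z" by (simp add: c_def s_def algebra_simps)
      moreover have "r / 2 \<le> s * r" using s(1) r(1) by simp
      ultimately have "w \<in> cball ((1 - s) *\<^sub>R x + s *\<^sub>R z) (s * r)" using w by simp
      moreover have "s > 0" using s(1) by simp
      ultimately obtain y where "y \<in> cball z r" "w = (1 - s) *\<^sub>R x + s *\<^sub>R y"
        using cball_combinationE by metis
      then show "w \<in> C" using cv x(1) r(2) s \<open>s > 0\<close> unfolding convex_alt by (meson less_imp_le subsetD)
    qed
    have "ennreal (real N * ?V) = (\<Sum>k<N. emeasure lborel (ball (c k) (r / 2)))"
      using V by (simp add: Vball ennreal_mult ennreal_of_nat_eq_real_of_nat)
    also have "\<dots> = emeasure lborel (\<Union>k<N. ball (c k) (r / 2))"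
      by (rule sum_emeasure) (use disj in auto)
    also have "\<dots> \<le> emeasure lborel C" using sub Cm by (intro emeasure_mono) auto
    finally show ?thesis .
  qed
  obtain v where v: "emeasure lborel C = ennreal v" "v \<ge> 0" using fin by (cases "emeasure lborel C") auto
  obtain N where "v < real N * ?V" using reals_Archimedean3[OF V] by blast
  then show False using big[of N] v by (simp add: ennreal_le_iff)
qed

text \<open>
  A superlevel set has finite measure by Markov's inequality and contains a ball once the level is
  lowered, so it is bounded; this is coercivity.
\<close>

lemma Phi_of_integrable:
  fixes f :: "'a::euclidean_space \<Rightarrow> ereal"
  assumes fin: "\<And>x. f x \<noteq> \<infinity>" and cv: "convex (hypograph f)" and cl: "closed (hypograph f)"
    and r: "r > 0" and low: "\<And>y. y \<in> cball z r \<Longrightarrow> ereal b \<le> f y"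
    and int: "(\<integral>\<^sup>+x. exp_ereal (f x) \<partial>lborel) < \<infinity>"
  shows "f \<in> Phi"
proof -
  have "bounded {x. ereal a \<le> f x}" for a
  proof -
    define m where "m = min a b"
    let ?C = "{x. ereal m \<le> f x}"
    have m: "ereal m \<le> ereal a" "ereal m \<le> ereal b" by (auto simp: m_def)
    have Cm: "?C \<in> sets lborel" using closed_superlevel[OF cl, of m] by simp
    have "ennreal (exp m) * emeasure lborel ?C = (\<integral>\<^sup>+x. ennreal (exp m) * indicator ?C x \<partial>lborel)"
      using Cm by (simp add: nn_integral_cmult_indicator)
    also have "\<dots> \<le> (\<integral>\<^sup>+x. exp_ereal (f x) \<partial>lborel)"
      using exp_ereal_mono[of "ereal m"] by (intro nn_integral_mono) (auto simp: indicator_def)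
    also note int
    finally have "emeasure lborel ?C < \<infinity>"
      by (auto simp: ennreal_mult_less_top)
    moreover have "cball z r \<subseteq> ?C" using order_trans[OF m(2) low] by blast
    ultimately have "bounded ?C"
      by (intro bounded_convex_of_finite_measure[OF convex_superlevel[OF cv] Cm r])
    then show ?thesis by (rule bounded_subset) (use order_trans[OF m(1)] in blast)
  qed
  then show ?thesis using fin cv cl by (simp add: Phi_iff_hypograph)
qed

section \<open>Existence of a maximizer\<close>

text \<open>
  The concavity inequalities pass to the lower limit, up to an arbitrarily small error.
\<close>

lemma convex_hypograph_liminf:
  assumes cv: "\<And>n. convex (hypograph (f n))"
  shows "convex (hypograph (\<lambda>x. liminf (\<lambda>n. f n x)))"
  unfolding convex_alt
proof (intro ballI allI impI, clarsimp)
  fix x a y b and t :: real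
  assume a: "ereal a \<le> liminf (\<lambda>n. f n x)" and b: "ereal b \<le> liminf (\<lambda>n. f n y)" and t: "0 \<le> t" "t \<le> 1"
  let ?w = "(1 - t) *\<^sub>R x + t *\<^sub>R y" and ?v = "(1 - t) * a + t * b"
  show "ereal ?v \<le> liminf (\<lambda>n. f n ?w)"
  proof (rule ereal_le_epsilon2)
    fix e :: real assume e: "0 < e"
    have "\<forall>\<^sub>F n in sequentially. ereal (a - e) < f n x" "\<forall>\<^sub>F n in sequentially. ereal (b - e) < f n y"
      using e by (auto intro!: less_LiminfD less_le_trans[OF _ a] less_le_trans[OF _ b])
    then have "\<forall>\<^sub>F n in sequentially. ereal (?v - e) \<le> f n ?w"
    proof eventually_elim
      case (elim n)
      then have "ereal ((1 - t) * (a - e) + t * (b - e)) \<le> f n ?w"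
        using t by (intro convex_hypographD cv) auto
      then show ?case by (simp add: algebra_simps)
    qed
    then have "ereal (?v - e) \<le> liminf (\<lambda>n. f n ?w)" by (rule Liminf_bounded)
    then show "ereal ?v \<le> liminf (\<lambda>n. f n ?w) + ereal e"
      by (cases "liminf (\<lambda>n. f n ?w)") auto
  qed
qed

text \<open>
  The weights \<open>2 ^ n\<close> keep the sum of the integrals of the squared increments finite, so almost
  everywhere the weighted squares are summable; by the inequality of the means
  \<open>2 * t \<le> 2 ^ n * t\<^sup>2 + (1/2) ^ n\<close> the increments themselves are then absolutely summable.
\<close>

lemma AE_convergent_of_fast_L2_Cauchy:
  fixes h :: "nat \<Rightarrow> 'a \<Rightarrow> real"
  assumes [measurable]: "\<And>n. h n \<in> borel_measurable N"
    and fast: "\<And>n. (\<integral>\<^sup>+x. ennreal ((h (Suc n) x - h n x)\<^sup>2) \<partial>N) \<le> ennreal (2 * (1/8) ^ n)"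
  shows "AE x in N. convergent (\<lambda>n. h n x)"
proof -
  let ?d = "\<lambda>n x. (h (Suc n) x - h n x)\<^sup>2"
  have "(\<integral>\<^sup>+x. (\<Sum>n. ennreal (2 ^ n * ?d n x)) \<partial>N) = (\<Sum>n. \<integral>\<^sup>+x. ennreal (2 ^ n * ?d n x) \<partial>N)"
    by (rule nn_integral_suminf) measurable
  also have "\<dots> = (\<Sum>n. ennreal (2 ^ n) * \<integral>\<^sup>+x. ennreal (?d n x) \<partial>N)"
    by (intro suminf_cong, subst nn_integral_cmult[symmetric]) (auto simp: ennreal_mult)
  also have "\<dots> \<le> (\<Sum>n. ennreal (2 * (1/4) ^ n))"
  proof (rule suminf_le)
    fix n
    have "ennreal (2 ^ n) * (\<integral>\<^sup>+x. ennreal (?d n x) \<partial>N) \<le> ennreal (2 ^ n) * ennreal (2 * (1/8) ^ n)"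
      by (rule mult_left_mono[OF fast]) simp
    also have "\<dots> = ennreal (2 * (1/4) ^ n)"
      by (simp add: ennreal_mult[symmetric] power_mult_distrib[symmetric] power_divide field_simps)
    finally show "ennreal (2 ^ n) * (\<integral>\<^sup>+x. ennreal (?d n x) \<partial>N) \<le> ennreal (2 * (1/4) ^ n)" .
  qed auto
  also have "\<dots> < \<infinity>"
    by (subst suminf_ennreal2) (auto intro!: summable_mult summable_geometric)
  finally have "AE x in N. (\<Sum>n. ennreal (2 ^ n * ?d n x)) \<noteq> \<infinity>"
    by (intro nn_integral_PInf_AE) auto
  then show ?thesis
  proof (rule AE_mp, intro AE_I2 impI)
    fix x assume "(\<Sum>n. ennreal (2 ^ n * ?d n x)) \<noteq> \<infinity>"
    then have s1: "summable (\<lambda>n. 2 ^ n * ?d n x)"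
      by (intro summable_suminf_not_top) auto
    have s2: "summable (\<lambda>n. (1/2::real) ^ n)" by (intro summable_geometric) auto
    have "summable (\<lambda>n. h (Suc n) x - h n x)"
    proof (rule summable_comparison_test[OF _ summable_add[OF s1 s2]], intro exI allI impI)
      fix n
      let ?t = "\<bar>h (Suc n) x - h n x\<bar>" and ?p = "2 ^ n :: real"
      have "0 \<le> (?p * ?t - 1)\<^sup>2" by simp
      then have "2 * ?t * ?p \<le> (?p * ?t\<^sup>2 + 1 / ?p) * ?p"
        by (simp add: power2_eq_square algebra_simps)
      then have "2 * ?t \<le> ?p * ?t\<^sup>2 + 1 / ?p" by (simp only: mult_le_cancel_right) simp
      then have "?t \<le> ?p * ?t\<^sup>2 + 1 / ?p" by (rule order_trans[rotated]) simp
      then show "norm (h (Suc n) x - h n x) \<le> 2 ^ n * ?d n x + (1/2) ^ n" by (simp add: power_divide)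
    qed
    then have "convergent (\<lambda>n. \<Sum>i<n. h (Suc i) x - h i x)" by (simp add: summable_iff_convergent)
    then have "convergent (\<lambda>n. h n x - h 0 x)" by (simp only: sum_lessThan_telescope[of "\<lambda>n. h n x"])
    then show "convergent (\<lambda>n. h n x)" by (simp add: convergent_diff_const_right_iff)
  qed
qed

text \<open>
  Taking logarithms. The case \<open>w = 0\<close> corresponds to the limit \<open>-\<infinity>\<close>.
\<close>

lemma tendsto_of_exp_half_tendsto:
  assumes fin: "\<And>n. u n \<noteq> \<infinity>" and lim: "(\<lambda>n. exp_half (u n)) \<longlonglongrightarrow> w"
  obtains l where "u \<longlonglongrightarrow> l" "(\<lambda>n. exp_ereal (u n)) \<longlonglongrightarrow> exp_ereal l"
proof -
  have w0: "w \<ge> 0" by (rule LIMSEQ_le_const[OF lim]) auto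
  have "\<exists>l. u \<longlonglongrightarrow> l \<and> l \<noteq> \<infinity> \<and> exp_half l = w"
  proof (cases "w = 0")
    case False
    then have w: "w > 0" using w0 by simp
    have "(\<lambda>n. ereal (2 * ln (exp_half (u n)))) \<longlonglongrightarrow> ereal (2 * ln w)"
      using w by (intro tendsto_intros lim) auto
    moreover have "\<forall>\<^sub>F n in sequentially. ereal (2 * ln (exp_half (u n))) = u n"
      using order_tendstoD(1)[OF lim w]
    proof eventually_elim
      case (elim n)
      then show ?case using fin[of n] by (cases "u n") auto
    qed
    ultimately have "u \<longlonglongrightarrow> ereal (2 * ln w)" by (rule Lim_transform_eventually)
    then show ?thesis using w by (intro exI[of _ "ereal (2 * ln w)"]) auto
  next
    case True
    have "u \<longlonglongrightarrow> -\<infinity>" unfolding tendsto_MInfty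
    proof
      fix B
      have "\<forall>\<^sub>F n in sequentially. exp_half (u n) < exp (B / 2)"
        using order_tendstoD(2)[OF lim] True by simp
      then show "\<forall>\<^sub>F n in sequentially. u n < ereal B"
      proof eventually_elim
        case (elim n)
        then show ?case using fin[of n] by (cases "u n") auto
      qed
    qed
    then show ?thesis using True by (intro exI[of _ "-\<infinity>"]) auto
  qed
  then obtain l where l: "u \<longlonglongrightarrow> l" "l \<noteq> \<infinity>" "exp_half l = w" by blast
  have "(\<lambda>n. ennreal ((exp_half (u n))\<^sup>2)) \<longlonglongrightarrow> ennreal (w\<^sup>2)" by (intro tendsto_intros lim)
  then have "(\<lambda>n. exp_ereal (u n)) \<longlonglongrightarrow> exp_ereal l"
    using l fin by (simp add: exp_ereal_eq_exp_half)
  with l(1) show ?thesis by (rule that)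
qed

lemma liminf_add_ennreal:
  fixes a b :: "nat \<Rightarrow> ennreal"
  shows "liminf a + liminf b \<le> liminf (\<lambda>n. a n + b n)"
proof -
  have "liminf a + liminf b = (SUP n. (INF m\<in>{n..}. a m) + (INF m\<in>{n..}. b m))"
    unfolding liminf_SUP_INF
    by (intro ennreal_SUP_add[symmetric] incseq_SucI INF_superset_mono) auto
  also have "\<dots> \<le> (SUP n. INF m\<in>{n..}. a m + b m)"
    by (intro SUP_mono' INF_greatest add_mono INF_lower)
  finally show ?thesis unfolding liminf_SUP_INF .
qed

context borel_prob_space
begin

text \<open>
  The maximizing sequence \<open>\<phi>\<close> is chosen to satisfy \<open>L_fun (\<phi> n) Q \<ge> S - (1/8) ^ n\<close>, which makes
  \<open>exp_half \<circ> \<phi> n\<close> convergent almost everywhere. The maximizer \<open>\<psi>\<close> is the upper semicontinuous hull of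
  the lower limit \<open>\<psi>0\<close>. For the integral over \<open>Q\<close>, which may charge Lebesgue null sets, an
  inequality at every point is required: \<open>limsup \<phi> \<le> \<psi>\<close>. For the Lebesgue integral, convergence almost
  everywhere suffices.
\<close>

lemma maximizer_exists:
  assumes z: "z \<in> interior (csupp Q)" and S: "\<And>h. h \<in> Phi \<Longrightarrow> L_fun h Q \<le> ereal S"
    and approx: "\<And>e. e > 0 \<Longrightarrow> \<exists>f\<in>Phi. ereal (S - e) \<le> L_fun f Q"
  shows "\<exists>\<psi>\<in>Phi. ereal S \<le> L_fun \<psi> Q"
proof -
  have "\<forall>n. \<exists>f. f \<in> Phi \<and> ereal (S - (1/8) ^ n) \<le> L_fun f Q" using approx by (metis zero_less_divide_1_iff zero_less_numeral zero_less_power)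
  then obtain \<phi> where \<phi>: "\<And>n. \<phi> n \<in> Phi" "\<And>n. ereal (S - (1/8) ^ n) \<le> L_fun (\<phi> n) Q" by metis
  have near: "ereal (S - 1) \<le> L_fun (\<phi> n) Q" for n
  proof -
    have "S - 1 \<le> S - (1/8) ^ n" by (simp add: power_le_one)
    then show ?thesis using \<phi>(2)[of n] by (meson ereal_less_eq(3) order_trans)
  qed
  obtain r M0 K where r: "r > 0" and
    M0: "M0 \<ge> 0" "\<And>f x. \<lbrakk>f \<in> Phi; L_fun f Q \<ge> ereal (- (1 - S))\<rbrakk> \<Longrightarrow> f x \<le> ereal M0" and
    K: "\<And>f x. \<lbrakk>f \<in> Phi; L_fun f Q \<ge> ereal (- (1 - S)); x \<in> cball z r\<rbrakk> \<Longrightarrow> ereal (- K) \<le> f x"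
    using Phi_uniform_bounds[OF z, of "1 - S"] by metis
  \<comment> \<open>The bound \<open>M \<ge> S\<close> keeps \<open>M + 1 - S\<close> nonnegative, so that \<open>ennreal\<close> does not truncate it.\<close>
  define M where "M = max M0 S"
  have M: "M \<ge> 0" "M \<ge> S" "ereal M0 \<le> ereal M" using M0 by (auto simp: M_def)
  have up: "\<phi> n x \<le> ereal M" for n x
    using M0(2)[OF \<phi>(1), of n x] near[of n] M(3) by (simp add: order_trans)
  have low: "ereal (- K) \<le> \<phi> n y" if "y \<in> cball z r" for n y
    using K[OF \<phi>(1) _ that, of n] near[of n] by simp
  have fin: "\<phi> n x \<noteq> \<infinity>" for n x using \<phi>(1) by (simp add: Phi_iff_hypograph)
  have cvn: "convex (hypograph (\<phi> n))" for n using \<phi>(1) by (simp add: Phi_iff_hypograph)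
  have [measurable]: "\<phi> n \<in> borel_measurable borel" for n using \<phi>(1) by (rule borel_measurable_Phi)
  have [measurable]: "\<phi> n \<in> borel_measurable Q" for n by simp

  define \<psi>0 where "\<psi>0 x = liminf (\<lambda>n. \<phi> n x)" for x
  define \<psi> where "\<psi> = usc_hull \<psi>0"
  have cv0: "convex (hypograph \<psi>0)"
    using convex_hypograph_liminf[OF cvn] by (simp add: \<psi>0_def[abs_def])
  have up0: "\<psi>0 x \<le> ereal M" for x
  proof -
    have "liminf (\<lambda>n. \<phi> n x) \<le> limsup (\<lambda>n. \<phi> n x)" by (rule Liminf_le_Limsup) simp
    also have "\<dots> \<le> ereal M" by (rule Limsup_bounded) (simp add: up)
    finally show ?thesis by (simp add: \<psi>0_def)
  qed
  have up\<psi>: "\<psi> x \<le> ereal M" for x unfolding \<psi>_def using up0 by (rule usc_hull_le)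
  have ge\<psi>: "\<psi>0 x \<le> \<psi> x" for x unfolding \<psi>_def by (rule usc_hull_ge)
  have cl\<psi>: "closed (hypograph \<psi>)" and cv\<psi>: "convex (hypograph \<psi>)"
    using cv0 by (auto simp: \<psi>_def hypograph_usc_hull)
  have [measurable]: "\<psi> \<in> borel_measurable borel" by (rule borel_measurable_closed_hypograph[OF cl\<psi>])
  have [measurable]: "\<psi> \<in> borel_measurable Q" by simp

  have "AE x in lborel. convergent (\<lambda>n. exp_half (\<phi> n x))"
  proof (rule AE_convergent_of_fast_L2_Cauchy)
    fix n
    have "S - (1/8) ^ n \<le> S - (1/8) ^ Suc n" by simp
    then have "ereal (S - (1/8) ^ n) \<le> L_fun (\<phi> (Suc n)) Q" using \<phi>(2)[of "Suc n"] by (meson ereal_less_eq(3) order_trans)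
    then show "(\<integral>\<^sup>+x. ennreal ((exp_half (\<phi> (Suc n) x) - exp_half (\<phi> n x))\<^sup>2) \<partial>lborel) \<le> ennreal (2 * (1/8) ^ n)"
      using near_maximizers_L2_close[of S "\<phi> (Suc n)" "(1/8) ^ n" "\<phi> n"] S \<phi> by simp
  qed measurable
  then have conv: "AE x in lborel. (\<lambda>n. \<phi> n x) \<longlonglongrightarrow> \<psi>0 x \<and> (\<lambda>n. exp_ereal (\<phi> n x)) \<longlonglongrightarrow> exp_ereal (\<psi>0 x)"
  proof (rule AE_mp, intro AE_I2 impI)
    fix x assume "convergent (\<lambda>n. exp_half (\<phi> n x))"
    then obtain w where w: "(\<lambda>n. exp_half (\<phi> n x)) \<longlonglongrightarrow> w" by (auto simp: convergent_def)
    obtain l where l: "(\<lambda>n. \<phi> n x) \<longlonglongrightarrow> l" "(\<lambda>n. exp_ereal (\<phi> n x)) \<longlonglongrightarrow> exp_ereal l"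
      using tendsto_of_exp_half_tendsto[OF _ w] fin by metis
    have "\<psi>0 x = l" unfolding \<psi>0_def by (rule lim_imp_Liminf[OF _ l(1)]) simp
    then show "(\<lambda>n. \<phi> n x) \<longlonglongrightarrow> \<psi>0 x \<and> (\<lambda>n. exp_ereal (\<phi> n x)) \<longlonglongrightarrow> exp_ereal (\<psi>0 x)" using l by simp
  qed

  \<comment> \<open>Infinitely many \<open>\<phi> n\<close> exceed \<open>a\<close> at \<open>x\<close>, and all are at least \<open>- K\<close> on the ball. By concavity infinitely
    many are nearly \<open>a\<close> at the points near \<open>x\<close> where the sequence converges, so the limit is nearly \<open>a\<close> there.\<close>
  have limsup_le: "limsup (\<lambda>n. \<phi> n x) \<le> \<psi> x" for x
  proof (rule ccontr)
    assume "\<not> limsup (\<lambda>n. \<phi> n x) \<le> \<psi> x"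
    then have "\<psi> x < limsup (\<lambda>n. \<phi> n x)" by simp
    then obtain a where a: "\<psi> x < ereal a" "ereal a < limsup (\<lambda>n. \<phi> n x)"
      using ereal_dense2[of "\<psi> x"] by blast
    have freq: "\<exists>\<^sub>F n in sequentially. ereal a \<le> \<phi> n x"
    proof (rule ccontr)
      assume "\<not> (\<exists>\<^sub>F n in sequentially. ereal a \<le> \<phi> n x)"
      then have "\<forall>\<^sub>F n in sequentially. \<phi> n x \<le> ereal a"
        unfolding not_frequently by (rule eventually_mono) auto
      then have "limsup (\<lambda>n. \<phi> n x) \<le> ereal a" by (rule Limsup_bounded)
      then show False using a(2) by simp
    qed
    have "ereal a \<le> \<psi> x"
    proof (rule hypograph_mem_of_AE_near_segment[OF cl\<psi> r conv, where b = "- K"])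
      fix s :: real and y assume s: "0 < s" "s < 1" and y: "y \<in> cball z r"
      let ?w = "(1 - s) *\<^sub>R x + s *\<^sub>R y" and ?v = "(1 - s) * a + s * (- K)"
      assume lim: "(\<lambda>n. \<phi> n ?w) \<longlonglongrightarrow> \<psi>0 ?w \<and> (\<lambda>n. exp_ereal (\<phi> n ?w)) \<longlonglongrightarrow> exp_ereal (\<psi>0 ?w)"
      have freqw: "\<exists>\<^sub>F n in sequentially. ereal ?v \<le> \<phi> n ?w"
        using freq
      proof (rule frequently_elim1)
        fix n assume "ereal a \<le> \<phi> n x"
        then show "ereal ?v \<le> \<phi> n ?w" using s low[OF y] by (intro convex_hypographD cvn) auto
      qed
      have "ereal ?v \<le> \<psi>0 ?w"
      proof (rule ccontr)
        assume "\<not> ereal ?v \<le> \<psi>0 ?w"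
        then have "\<forall>\<^sub>F n in sequentially. \<phi> n ?w < ereal ?v" using order_tendstoD(2) lim by (metis not_le)
        then have "\<not> (\<exists>\<^sub>F n in sequentially. ereal ?v \<le> \<phi> n ?w)"
          unfolding not_frequently by (rule eventually_mono) auto
        then show False using freqw by simp
      qed
      then show "ereal ?v \<le> \<psi> ?w" using ge\<psi> by (rule order_trans)
    qed
    then show False using a(1) by simp
  qed

  have I1: "(\<integral>\<^sup>+x. e2ennreal (ereal M - \<psi> x) \<partial>Q) \<le> liminf (\<lambda>n. \<integral>\<^sup>+x. e2ennreal (ereal M - \<phi> n x) \<partial>Q)"
  proof -
    have "e2ennreal (ereal M - \<psi> x) \<le> liminf (\<lambda>n. e2ennreal (ereal M - \<phi> n x))" for x
    proof -
      have "liminf (\<lambda>n. ereal M - \<phi> n x) = ereal M + liminf (\<lambda>n. - \<phi> n x)"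
        unfolding minus_ereal_def by (rule Liminf_add_ereal_left) auto
      also have "\<dots> = ereal M - limsup (\<lambda>n. \<phi> n x)"
        by (simp add: ereal_Liminf_uminus minus_ereal_def)
      finally have eq: "liminf (\<lambda>n. ereal M - \<phi> n x) = ereal M - limsup (\<lambda>n. \<phi> n x)" .
      have "e2ennreal (ereal M - \<psi> x) \<le> e2ennreal (liminf (\<lambda>n. ereal M - \<phi> n x))"
        unfolding eq by (intro e2ennreal_mono ereal_minus_mono limsup_le) simp
      also have "\<dots> = liminf (\<lambda>n. e2ennreal (ereal M - \<phi> n x))"
        by (intro Liminf_compose_continuous_mono[symmetric] continuous_on_e2ennreal monoI e2ennreal_mono) auto
      finally show ?thesis .
    qed
    then have "(\<integral>\<^sup>+x. e2ennreal (ereal M - \<psi> x) \<partial>Q) \<le> (\<integral>\<^sup>+x. liminf (\<lambda>n. e2ennreal (ereal M - \<phi> n x)) \<partial>Q)"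
      by (intro nn_integral_mono)
    also have "\<dots> \<le> liminf (\<lambda>n. \<integral>\<^sup>+x. e2ennreal (ereal M - \<phi> n x) \<partial>Q)"
      by (rule nn_integral_liminf) measurable
    finally show ?thesis .
  qed
  have I2: "(\<integral>\<^sup>+x. exp_ereal (\<psi> x) \<partial>lborel) \<le> liminf (\<lambda>n. \<integral>\<^sup>+x. exp_ereal (\<phi> n x) \<partial>lborel)"
  proof -
    have "AE x in lborel. exp_ereal (\<psi> x) = liminf (\<lambda>n. exp_ereal (\<phi> n x))"
      using conv AE_usc_hull_eq[OF cv0]
    proof eventually_elim
      case (elim x)
      then have "liminf (\<lambda>n. exp_ereal (\<phi> n x)) = exp_ereal (\<psi>0 x)" by (intro lim_imp_Liminf) auto
      then show ?case using elim by (simp add: \<psi>_def)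
    qed
    then have "(\<integral>\<^sup>+x. exp_ereal (\<psi> x) \<partial>lborel) = (\<integral>\<^sup>+x. liminf (\<lambda>n. exp_ereal (\<phi> n x)) \<partial>lborel)"
      by (rule nn_integral_cong_AE)
    also have "\<dots> \<le> liminf (\<lambda>n. \<integral>\<^sup>+x. exp_ereal (\<phi> n x) \<partial>lborel)"
      by (rule nn_integral_liminf) measurable
    finally show ?thesis .
  qed
  have "cost M \<psi> \<le> liminf (\<lambda>n. cost M (\<phi> n))"
    unfolding cost_def using add_mono[OF I1 I2] liminf_add_ennreal by (rule order_trans)
  also have "\<dots> \<le> liminf (\<lambda>n. ennreal (M + 1 - (S - (1/8) ^ n)))"
    using \<phi> up M(1) by (intro Liminf_mono always_eventually allI cost_le_of_L_fun_ge) auto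
  also have "\<dots> = ennreal (M + 1 - (S - 0))"
    by (intro lim_imp_Liminf tendsto_intros LIMSEQ_power_zero) auto
  finally have cost: "cost M \<psi> \<le> ennreal (M + 1 - S)" by simp
  then have "ereal S \<le> L_fun \<psi> Q"
    unfolding L_fun_eq_cost[OF \<open>\<psi> \<in> borel_measurable borel\<close> up\<psi> M(1)]
    using M by (cases "cost M \<psi>") (auto simp: top_unique ennreal_le_iff)
  moreover have "\<psi> \<in> Phi"
  proof (rule Phi_of_integrable[OF _ cv\<psi> cl\<psi> r])
    show "\<psi> x \<noteq> \<infinity>" for x using up\<psi>[of x] by auto
    show "ereal (- K) \<le> \<psi> y" if "y \<in> cball z r" for y
    proof -
      have "ereal (- K) \<le> \<psi>0 y" unfolding \<psi>0_def using low[OF that] by (intro Liminf_bounded always_eventually allI)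
      then show ?thesis using ge\<psi> by (rule order_trans)
    qed
    have "(\<integral>\<^sup>+x. exp_ereal (\<psi> x) \<partial>lborel) \<le> cost M \<psi>" by (simp add: cost_def)
    also have "\<dots> < \<infinity>" using cost by (rule le_less_trans) simp
    finally show "(\<integral>\<^sup>+x. exp_ereal (\<psi> x) \<partial>lborel) < \<infinity>" .
  qed
  ultimately show ?thesis by blast
qed

end

section \<open>When the supremum is real, and properties of the maximizer\<close>

lemma Phi_restrict:
  fixes f :: "'a::euclidean_space \<Rightarrow> ereal"
  assumes f: "f \<in> Phi" and C: "closed C" "convex C"
  shows "(\<lambda>x. if x \<in> C then f x else -\<infinity>) \<in> Phi"
proof -
  let ?g = "\<lambda>x. if x \<in> C then f x else -\<infinity>"
  have hyp: "hypograph ?g = hypograph f \<inter> C \<times> UNIV" by (auto split: if_splits)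
  have "bounded {x. ereal a \<le> ?g x}" for a
    by (rule bounded_subset[of "{x. ereal a \<le> f x}"]) (use f in \<open>auto simp: Phi_iff_hypograph split: if_splits\<close>)
  then show ?thesis
    using f C unfolding Phi_iff_hypograph hyp
    by (auto intro!: convex_Int closed_Int convex_Times closed_Times)
qed

lemma Phi_shift:
  fixes f :: "'a::euclidean_space \<Rightarrow> ereal"
  assumes f: "f \<in> Phi"
  shows "(\<lambda>x. f x + ereal c) \<in> Phi"
proof -
  let ?g = "\<lambda>x. f x + ereal c"
  have shift: "ereal a \<le> ?g x \<longleftrightarrow> ereal (a - c) \<le> f x" for a x by (cases "f x") auto
  have hyp: "hypograph ?g = (+) (0, c) ` hypograph f"
  proof (intro set_eqI iffI)
    fix p assume "p \<in> hypograph ?g"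
    then have "(fst p, snd p - c) \<in> hypograph f" using shift[of "snd p" "fst p"] by (simp add: hypograph_def)
    then show "p \<in> (+) (0, c) ` hypograph f"
      by (intro image_eqI[of _ _ "(fst p, snd p - c)"]) (simp_all add: prod_eq_iff)
  qed (use shift in auto)
  have "{x. ereal a \<le> ?g x} = {x. ereal (a - c) \<le> f x}" for a by (simp only: shift)
  then show ?thesis
    using f unfolding Phi_iff_hypograph hyp by (simp add: convex_translation closed_translation)
qed

lemma Phi_minus_norm: "(\<lambda>x::'a::euclidean_space. ereal (c - norm x)) \<in> Phi"
proof -
  let ?g = "\<lambda>x::'a. ereal (c - norm x)"
  have hyp: "hypograph ?g = {p. norm (fst p) + snd p \<le> c}" by (auto simp: hypograph_def)
  have "closed (hypograph ?g)" unfolding hyp by (intro closed_Collect_le continuous_intros)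
  moreover have "convex (hypograph ?g)"
    unfolding hyp convex_alt
  proof (intro ballI allI impI, clarsimp)
    fix x y :: 'a and a b t :: real
    assume *: "norm x + a \<le> c" "norm y + b \<le> c" "0 \<le> t" "t \<le> 1"
    have "norm ((1 - t) *\<^sub>R x + t *\<^sub>R y) \<le> (1 - t) * norm x + t * norm y"
      using norm_triangle_ineq[of "(1 - t) *\<^sub>R x" "t *\<^sub>R y"] * by simp
    moreover have "(1 - t) * (norm x + a) + t * (norm y + b) \<le> (1 - t) * c + t * c"
      using * by (intro add_mono mult_left_mono) auto
    ultimately show "norm ((1 - t) *\<^sub>R x + t *\<^sub>R y) + ((1 - t) * a + t * b) \<le> c"
      by (simp add: algebra_simps)
  qed
  moreover have "bounded {x. ereal a \<le> ?g x}" for a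
    by (rule boundedI[of _ "c - a"]) simp
  ultimately show ?thesis by (simp add: Phi_iff_hypograph)
qed

context borel_prob_space
begin

text \<open>
  The linear upper bound for \<open>f\<close> turns the infinite first moment into an infinite cost.
\<close>

lemma L_fun_infinite_moment:
  assumes inf: "(\<integral>\<^sup>+x. ennreal (norm x) \<partial>Q) = \<infinity>" and f: "f \<in> Phi"
  shows "L_fun f Q = -\<infinity>"
proof -
  obtain a b where ab: "b > 0" "a \<ge> 0" "\<And>x. f x \<le> ereal (a - b * norm x)"
    using Phi_linear_bound[OF f] by blast
  have fa: "f x \<le> ereal a" for x
  proof -
    have "a - b * norm x \<le> a" using ab(1) by simp
    then show ?thesis using ab(3)[of x] by (meson ereal_less_eq(3) order_trans)
  qed
  have "\<infinity> = ennreal b * (\<integral>\<^sup>+x. ennreal (norm x) \<partial>Q)"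
    using ab(1) inf by (simp add: ennreal_mult_top)
  also have "\<dots> = (\<integral>\<^sup>+x. ennreal (b * norm x) \<partial>Q)"
    using ab(1) by (subst nn_integral_cmult[symmetric]) (auto simp: ennreal_mult)
  also have "\<dots> \<le> (\<integral>\<^sup>+x. e2ennreal (ereal a - f x) \<partial>Q)"
  proof (rule nn_integral_mono)
    fix x
    have "ereal (b * norm x) \<le> ereal a - f x" using ab(3)[of x] by (cases "f x") auto
    then show "ennreal (b * norm x) \<le> e2ennreal (ereal a - f x)"
      using e2ennreal_mono[of "ereal (b * norm x)"] by simp
  qed
  finally have "cost a f = \<infinity>" by (simp add: cost_def top_unique)
  then show ?thesis
    using L_fun_eq_cost[OF borel_measurable_Phi[OF f] fa ab(2)] by simp
qed

text \<open>
  These explicit test functions give both the finite lower bound for the supremum (\<open>C = UNIV\<close>) and its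
  divergence in the degenerate case (\<open>C\<close> a hyperplane).
\<close>

lemma L_fun_minus_norm_restricted:
  assumes C: "closed C" "convex C" "AE x in Q. x \<in> C" and c: "c \<ge> 0"
  defines "f \<equiv> \<lambda>x. if x \<in> C then ereal (c - norm x) else -\<infinity>"
  shows "f \<in> Phi"
    "L_fun f Q = ereal (c + 1) - enn2ereal ((\<integral>\<^sup>+x. ennreal (norm x) \<partial>Q) + (\<integral>\<^sup>+x. exp_ereal (f x) \<partial>lborel))"
proof -
  show f: "f \<in> Phi" unfolding f_def by (rule Phi_restrict[OF Phi_minus_norm C(1,2)])
  have le: "f x \<le> ereal c" for x by (simp add: f_def)
  have "(\<integral>\<^sup>+x. e2ennreal (ereal c - f x) \<partial>Q) = (\<integral>\<^sup>+x. ennreal (norm x) \<partial>Q)"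
    by (rule nn_integral_cong_AE, rule AE_mp[OF C(3)]) (simp add: f_def)
  then show "L_fun f Q = ereal (c + 1) - enn2ereal ((\<integral>\<^sup>+x. ennreal (norm x) \<partial>Q) + (\<integral>\<^sup>+x. exp_ereal (f x) \<partial>lborel))"
    using L_fun_eq_cost[OF borel_measurable_Phi[OF f] le c] by (simp add: cost_def)
qed

lemma L_sup_infinite_if_degenerate:
  assumes fin: "(\<integral>\<^sup>+x. ennreal (norm x) \<partial>Q) < \<infinity>" and deg: "interior (csupp Q) = {}"
  shows "L_sup Q = \<infinity>"
proof -
  obtain a b where ab: "a \<noteq> 0" "csupp Q \<subseteq> {x. a \<bullet> x = b}"
    using empty_interior_subset_hyperplane[OF convex_csupp deg] by blast
  let ?H = "{x. a \<bullet> x = b}"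
  have H: "closed ?H" "convex ?H" by (auto intro: closed_hyperplane convex_hyperplane)
  have aeQ: "AE x in Q. x \<in> ?H" by (rule AE_mp[OF AE_in_csupp]) (use ab in auto)
  have "?H \<in> null_sets lborel"
    using negligible_hyperplane[of a b] ab(1) H(1) by (simp add: negligible_iff_null_sets null_sets_completion_iff)
  then have aeH: "AE x in lborel. x \<notin> ?H" by (rule AE_not_in)
  obtain m where m: "(\<integral>\<^sup>+x. ennreal (norm x) \<partial>Q) = ennreal m" "m \<ge> 0"
    using fin by (cases "\<integral>\<^sup>+x. ennreal (norm x) \<partial>Q") auto
  have "ereal (real n) \<le> L_sup Q" for n :: nat
  proof -
    \<comment> \<open>The first moment \<open>m\<close> is added so that the value comes out as \<open>n + 1\<close>.\<close>
    let ?f = "\<lambda>x. if x \<in> ?H then ereal (real n + m - norm x) else -\<infinity>"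
    have "(\<integral>\<^sup>+x. exp_ereal (?f x) \<partial>lborel) = (\<integral>\<^sup>+x. 0 \<partial>(lborel :: 'a measure))"
      by (rule nn_integral_cong_AE, rule AE_mp[OF aeH]) simp
    then have "L_fun ?f Q = ereal (real n + 1)"
      using L_fun_minus_norm_restricted(2)[OF H aeQ, of "real n + m"] m by simp
    then have "ereal (real n) \<le> L_fun ?f Q" by simp
    also have "\<dots> \<le> L_sup Q"
      unfolding L_sup_def using L_fun_minus_norm_restricted(1)[OF H aeQ, of "real n + m"] m(2)
      by (intro SUP_upper) simp
    finally show ?thesis .
  qed
  then show ?thesis
    by (cases "L_sup Q") (metis PInfty_neq_ereal(1) ereal_less_eq(3) linorder_not_le reals_Archimedean2, auto)
qed

text \<open>
  Functions with nonnegative value share an upper bound \<open>M\<close>, and then their value is at most \<open>M + 1\<close>.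
\<close>

lemma L_sup_finite:
  assumes fin: "(\<integral>\<^sup>+x. ennreal (norm x) \<partial>Q) < \<infinity>" and z: "z \<in> interior (csupp Q)"
  shows "\<bar>L_sup Q\<bar> \<noteq> \<infinity>"
proof -
  let ?f = "\<lambda>x::'a. if x \<in> UNIV then ereal (0 - norm x) else -\<infinity>"
  have f: "?f \<in> Phi"
    and Lf: "L_fun ?f Q = ereal (0 + 1) - enn2ereal ((\<integral>\<^sup>+x. ennreal (norm x) \<partial>Q) + (\<integral>\<^sup>+x. exp_ereal (?f x) \<partial>lborel))"
    using L_fun_minus_norm_restricted[of UNIV 0] by auto
  have "(\<integral>\<^sup>+x. ennreal (norm x) \<partial>Q) + (\<integral>\<^sup>+x. exp_ereal (?f x) \<partial>lborel) < \<infinity>"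
    using fin nn_integral_exp_Phi_finite[OF f] by (simp add: ennreal_add_less_top)
  then have "L_fun ?f Q \<noteq> -\<infinity>" unfolding Lf
    by (cases "(\<integral>\<^sup>+x. ennreal (norm x) \<partial>Q) + (\<integral>\<^sup>+x. exp_ereal (?f x) \<partial>lborel)") auto
  moreover have "L_fun ?f Q \<le> L_sup Q" unfolding L_sup_def using f by (rule SUP_upper)
  ultimately have "L_sup Q \<noteq> -\<infinity>" by auto
  moreover
  obtain M where M: "M \<ge> 0" "\<And>f x. \<lbrakk>f \<in> Phi; L_fun f Q \<ge> ereal (- 0)\<rbrakk> \<Longrightarrow> f x \<le> ereal M"
    using Phi_uniform_bounds[OF z, of 0] by metis
  have "L_sup Q \<le> ereal (M + 1)"
    unfolding L_sup_def
  proof (rule SUP_least)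
    fix f :: "'a \<Rightarrow> ereal" assume f: "f \<in> Phi"
    show "L_fun f Q \<le> ereal (M + 1)"
    proof (cases "L_fun f Q \<ge> ereal (- 0)")
      case True
      have "L_fun f Q = ereal (M + 1) - enn2ereal (cost M f)"
        by (rule L_fun_eq_cost[OF borel_measurable_Phi[OF f] M(2)[OF f True] M(1)])
      then show ?thesis by (cases "cost M f") auto
    next
      case False
      then have "L_fun f Q \<le> ereal 0" by simp
      also have "ereal 0 \<le> ereal (M + 1)" using M(1) by simp
      finally show ?thesis .
    qed
  qed
  ultimately show ?thesis by auto
qed

text \<open>
  Adding a constant \<open>c\<close> changes the value by \<open>c - (exp c - 1) * B\<close>, where \<open>B\<close> is the integral of \<open>exp f\<close>. At a
  maximizer this is at most 0 for all \<open>c\<close>, and \<open>c = - ln B\<close> gives \<open>B - 1 \<le> ln B\<close>, which only holds for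
  \<open>B = 1\<close>.
\<close>

lemma nn_integral_exp_maximizer:
  assumes S: "\<And>h. h \<in> Phi \<Longrightarrow> L_fun h Q \<le> ereal S" and f: "f \<in> Phi" "ereal S \<le> L_fun f Q"
  shows "(\<integral>\<^sup>+x. exp_ereal (f x) \<partial>lborel) = 1"
proof -
  have [measurable]: "f \<in> borel_measurable borel" by (rule borel_measurable_Phi[OF f(1)])
  have [measurable]: "f \<in> borel_measurable Q" by simp
  obtain M where M: "M \<ge> 0" "\<And>x. f x \<le> ereal M" using Phi_bounded_above[OF f(1)] by blast
  let ?A = "\<integral>\<^sup>+x. e2ennreal (ereal M - f x) \<partial>Q" and ?B = "\<integral>\<^sup>+x. exp_ereal (f x) \<partial>lborel"
  have Lf: "L_fun f Q = ereal (M + 1) - enn2ereal (?A + ?B)"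
    using L_fun_eq_cost[OF borel_measurable_Phi[OF f(1)] M(2) M(1)] by (simp add: cost_def)
  have "?A + ?B \<noteq> top" using f(2) unfolding Lf by auto
  then have "?A \<noteq> top" "?B \<noteq> top" by auto
  then obtain A where A: "?A = ennreal A" "A \<ge> 0" by (cases ?A) auto
  obtain B where B: "?B = ennreal B" "B \<ge> 0" using \<open>?B \<noteq> top\<close> by (cases ?B) auto
  have SB: "S \<le> M + 1 - (A + B)" using f(2) unfolding Lf A(1) B(1) using A B by (simp flip: ennreal_plus)
  have key: "B + c \<le> exp c * B" for c
  proof -
    \<comment> \<open>The absolute value keeps the bound nonnegative when \<open>c\<close> is negative.\<close>
    let ?g = "\<lambda>x. f x + ereal c" and ?N = "M + \<bar>c\<bar>"
    have g: "?g \<in> Phi" by (rule Phi_shift[OF f(1)])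
    have gN: "?g x \<le> ereal ?N" for x using M(2)[of x] by (cases "f x") auto
    have "(\<integral>\<^sup>+x. e2ennreal (ereal ?N - ?g x) \<partial>Q) = (\<integral>\<^sup>+x. e2ennreal (ereal M - f x) + ennreal (\<bar>c\<bar> - c) \<partial>Q)"
    proof (rule nn_integral_cong)
      fix x
      show "e2ennreal (ereal ?N - ?g x) = e2ennreal (ereal M - f x) + ennreal (\<bar>c\<bar> - c)"
        using M(2)[of x] by (cases "f x") (auto simp: ennreal_plus[symmetric] algebra_simps simp del: ennreal_plus)
    qed
    also have "\<dots> = ennreal (A + (\<bar>c\<bar> - c))"
      using A by (subst nn_integral_add) (auto simp flip: ennreal_plus)
    finally have 1: "(\<integral>\<^sup>+x. e2ennreal (ereal ?N - ?g x) \<partial>Q) = ennreal (A + (\<bar>c\<bar> - c))" .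
    have "exp_ereal (?g x) = ennreal (exp c) * exp_ereal (f x)" for x
      using M(2)[of x] by (cases "f x") (auto simp: exp_add ennreal_mult mult.commute)
    then have "(\<integral>\<^sup>+x. exp_ereal (?g x) \<partial>lborel) = ennreal (exp c) * ?B"
      by (simp add: nn_integral_cmult)
    then have 2: "(\<integral>\<^sup>+x. exp_ereal (?g x) \<partial>lborel) = ennreal (exp c * B)"
      using B by (simp add: ennreal_mult)
    have "L_fun ?g Q = ereal (?N + 1) - enn2ereal (cost ?N ?g)"
      using M(1) by (intro L_fun_eq_cost borel_measurable_Phi g gN) auto
    also have "cost ?N ?g = ennreal (A + (\<bar>c\<bar> - c) + exp c * B)"
      unfolding cost_def 1 2 using A B by (subst ennreal_plus) auto
    finally have "L_fun ?g Q = ereal (?N + 1 - (A + (\<bar>c\<bar> - c) + exp c * B))"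
      using A B by (subst (asm) enn2ereal_ennreal) auto
    then have "?N + 1 - (A + (\<bar>c\<bar> - c) + exp c * B) \<le> S" using S[OF g] by simp
    then show ?thesis using SB by simp
  qed
  have "B \<noteq> 0" using key[of 1] by auto
  then have Bpos: "B > 0" using B(2) by simp
  have "B - ln B \<le> 1" using key[of "- ln B"] Bpos by (simp add: exp_minus)
  then have "ln B = B - 1" using ln_le_minus_one[OF Bpos] by simp
  then have "B = 1" using ln_eq_minus_one[OF Bpos] by simp
  then show ?thesis using B by simp
qed

text \<open>
  Off the convex support, which has full probability, only the Lebesgue integral notices the
  change, and it does not increase.
\<close>

lemma L_fun_restrict_csupp_ge:
  assumes f: "f \<in> Phi"
  shows "L_fun f Q \<le> L_fun (\<lambda>x. if x \<in> csupp Q then f x else -\<infinity>) Q"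
proof -
  let ?g = "\<lambda>x. if x \<in> csupp Q then f x else -\<infinity>"
  have g: "?g \<in> Phi" by (rule Phi_restrict[OF f closed_csupp convex_csupp])
  obtain M where M: "M \<ge> 0" "\<And>x. f x \<le> ereal M" using Phi_bounded_above[OF f] by blast
  have gM: "?g x \<le> ereal M" for x using M(2) by simp
  have "(\<integral>\<^sup>+x. e2ennreal (ereal M - ?g x) \<partial>Q) = (\<integral>\<^sup>+x. e2ennreal (ereal M - f x) \<partial>Q)"
    by (rule nn_integral_cong_AE, rule AE_mp[OF AE_in_csupp]) simp
  moreover have "(\<integral>\<^sup>+x. exp_ereal (?g x) \<partial>lborel) \<le> (\<integral>\<^sup>+x. exp_ereal (f x) \<partial>lborel)"
    by (intro nn_integral_mono) simp
  ultimately have "cost M ?g \<le> cost M f" by (simp add: cost_def add_left_mono)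
  then show ?thesis
    unfolding L_fun_eq_cost[OF borel_measurable_Phi[OF f] M(2,1)] L_fun_eq_cost[OF borel_measurable_Phi[OF g] gM M(1)]
    by (intro ereal_minus_mono) (auto simp: less_eq_ennreal.rep_eq)
qed

text \<open>
  The lower bounds near each interior point of the convex support give the first inclusion. For the second one, the
  restriction of \<open>f\<close> to the convex support is again a maximizer, hence equal to \<open>f\<close>.
\<close>

lemma maximizer_domain:
  assumes z: "z \<in> interior (csupp Q)" and S: "\<And>h. h \<in> Phi \<Longrightarrow> L_fun h Q \<le> ereal S"
    and f: "f \<in> Phi" "ereal S \<le> L_fun f Q"
  shows "interior (csupp Q) \<subseteq> eff_dom f" "eff_dom f \<subseteq> csupp Q"
proof -
  show "interior (csupp Q) \<subseteq> eff_dom f"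
  proof
    fix x assume x: "x \<in> interior (csupp Q)"
    obtain r M K where "r > 0"
      and K: "\<And>f y. \<lbrakk>f \<in> Phi; L_fun f Q \<ge> ereal (- (- S)); y \<in> cball x r\<rbrakk> \<Longrightarrow> ereal (- K) \<le> f y"
      using Phi_uniform_bounds[OF x, of "- S"] by metis
    then have "ereal (- K) \<le> f x" using f by auto
    then show "x \<in> eff_dom f" by (auto simp: eff_dom_def)
  qed
  let ?g = "\<lambda>x. if x \<in> csupp Q then f x else -\<infinity>"
  have "?g \<in> Phi" by (rule Phi_restrict[OF f(1) closed_csupp convex_csupp])
  then have eq: "f = ?g"
    using order_trans[OF f(2) L_fun_restrict_csupp_ge[OF f(1)]] by (intro maximizer_unique[OF z S f])
  show "eff_dom f \<subseteq> csupp Q"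
  proof
    fix x assume x: "x \<in> eff_dom f"
    show "x \<in> csupp Q"
    proof (rule ccontr)
      assume "x \<notin> csupp Q"
      then have "f x = -\<infinity>" using fun_cong[OF eq, of x] by simp
      then show False using x by (simp add: eff_dom_def)
    qed
  qed
qed

lemma is_arg_max_iff_attains_L_sup:
  fixes f :: "'a \<Rightarrow> ereal"
  assumes S: "L_sup Q = ereal S"
  shows "is_arg_max (\<lambda>\<phi>. L_fun \<phi> Q) (\<lambda>\<phi>. \<phi> \<in> Phi) f \<longleftrightarrow> f \<in> Phi \<and> ereal S \<le> L_fun f Q"
  unfolding S[symmetric] L_sup_def is_arg_max_linorder SUP_le_iff by auto

text \<open>
  The exponential of the maximizer is the density of the log-concave projection of \<open>Q\<close>. Coordinates do
  not enter, so the result holds in every Euclidean space.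
\<close>

theorem log_concave_projection:
  "(\<bar>L_sup Q\<bar> \<noteq> \<infinity> \<longleftrightarrow>
            (\<integral>\<^sup>+x. ennreal (norm x) \<partial>Q) < \<infinity> \<and> interior (csupp Q) \<noteq> {})
       \<and> (\<bar>L_sup Q\<bar> \<noteq> \<infinity> \<longrightarrow>
            (\<exists>!\<psi>. is_arg_max (\<lambda>\<phi>. L_fun \<phi> Q) (\<lambda>\<phi>. \<phi> \<in> Phi) \<psi>)
          \<and> (\<forall>\<psi>. is_arg_max (\<lambda>\<phi>. L_fun \<phi> Q) (\<lambda>\<phi>. \<phi> \<in> Phi) \<psi> \<longrightarrow>
               (\<integral>\<^sup>+x. exp_ereal (\<psi> x) \<partial>lborel) = 1
             \<and> interior (csupp Q) \<subseteq> eff_dom \<psi> \<and> eff_dom \<psi> \<subseteq> csupp Q))"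
proof (intro conjI impI)
  show iff: "\<bar>L_sup Q\<bar> \<noteq> \<infinity> \<longleftrightarrow> (\<integral>\<^sup>+x. ennreal (norm x) \<partial>Q) < \<infinity> \<and> interior (csupp Q) \<noteq> {}"
  proof
    assume real: "\<bar>L_sup Q\<bar> \<noteq> \<infinity>"
    have fin: "(\<integral>\<^sup>+x. ennreal (norm x) \<partial>Q) < \<infinity>"
    proof (rule ccontr)
      assume "\<not> ?thesis"
      then have "(\<integral>\<^sup>+x. ennreal (norm x) \<partial>Q) = \<infinity>" by (simp flip: top.not_eq_extremum)
      then have "L_sup Q \<le> -\<infinity>"
        unfolding L_sup_def using L_fun_infinite_moment by (intro SUP_least) simp
      then show False using real by simp
    qed
    then show "(\<integral>\<^sup>+x. ennreal (norm x) \<partial>Q) < \<infinity> \<and> interior (csupp Q) \<noteq> {}"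
      using L_sup_infinite_if_degenerate real by auto
  next
    assume *: "(\<integral>\<^sup>+x. ennreal (norm x) \<partial>Q) < \<infinity> \<and> interior (csupp Q) \<noteq> {}"
    then obtain z where "z \<in> interior (csupp Q)" by auto
    then show "\<bar>L_sup Q\<bar> \<noteq> \<infinity>" by (rule L_sup_finite[OF conjunct1[OF *]])
  qed
  assume "\<bar>L_sup Q\<bar> \<noteq> \<infinity>"
  then obtain S where S: "L_sup Q = ereal S" by auto
  obtain z where z: "z \<in> interior (csupp Q)" using iff \<open>\<bar>L_sup Q\<bar> \<noteq> \<infinity>\<close> by blast
  have ub: "L_fun h Q \<le> ereal S" if "h \<in> Phi" for h :: "'a \<Rightarrow> ereal"
    unfolding S[symmetric] L_sup_def using that by (rule SUP_upper)
  have approx: "\<exists>f\<in>Phi. ereal (S - e) \<le> L_fun f Q" if "e > 0" for e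
  proof -
    have "ereal (S - e) < L_sup Q" using that S by simp
    then show ?thesis unfolding L_sup_def less_SUP_iff by (auto intro: less_imp_le)
  qed
  note am = is_arg_max_iff_attains_L_sup[OF S]
  show "\<exists>!\<psi>. is_arg_max (\<lambda>\<phi>. L_fun \<phi> Q) (\<lambda>\<phi>. \<phi> \<in> Phi) \<psi>"
    unfolding am using maximizer_exists[OF z ub approx] maximizer_unique[OF z ub] by blast
  show "\<forall>\<psi>. is_arg_max (\<lambda>\<phi>. L_fun \<phi> Q) (\<lambda>\<phi>. \<phi> \<in> Phi) \<psi> \<longrightarrow>
               (\<integral>\<^sup>+x. exp_ereal (\<psi> x) \<partial>lborel) = 1
             \<and> interior (csupp Q) \<subseteq> eff_dom \<psi> \<and> eff_dom \<psi> \<subseteq> csupp Q"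
    unfolding am using nn_integral_exp_maximizer[OF ub] maximizer_domain[OF z ub] by blast
qed

end

theorem theorem2p2:
  fixes Q :: "(real ^ 'n) measure"
  assumes "prob_space Q" and "sets Q = sets borel"
  shows "(\<bar>L_sup Q\<bar> \<noteq> \<infinity> \<longleftrightarrow>
            (\<integral>\<^sup>+x. ennreal (norm x) \<partial>Q) < \<infinity> \<and> interior (csupp Q) \<noteq> {})
       \<and> (\<bar>L_sup Q\<bar> \<noteq> \<infinity> \<longrightarrow>
            (\<exists>!\<psi>. is_arg_max (\<lambda>\<phi>. L_fun \<phi> Q) (\<lambda>\<phi>. \<phi> \<in> Phi) \<psi>)
          \<and> (\<forall>\<psi>. is_arg_max (\<lambda>\<phi>. L_fun \<phi> Q) (\<lambda>\<phi>. \<phi> \<in> Phi) \<psi> \<longrightarrow>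
               (\<integral>\<^sup>+x. exp_ereal (\<psi> x) \<partial>lborel) = 1
             \<and> interior (csupp Q) \<subseteq> eff_dom \<psi> \<and> eff_dom \<psi> \<subseteq> csupp Q))"
proof -
  interpret borel_prob_space Q
    using assms by (intro borel_prob_space.intro borel_prob_space_axioms.intro)
  show ?thesis by (rule log_concave_projection)
qed

end
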